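(* Let $K$ be a field, $m,n\ge 1$, let $X=(x_{ij})$ be the generic $m\times mn$ matrix, $Y=(y_{ij})$ the generic $mn\times n$ matrix, and $R=K[x_{ij},y_{kl}]$ the polynomial ring in all entries of $X$ and $Y$. Equip $R$ with the lexicographic monomial order induced by the following order of the variables: every $y$-variable is larger than every $x$-variable; every entry of $[Y]_s$ is larger than every entry of $[Y]_{s'}$ when $s<s'$; within $[Y]_s$ the entries decrease from top to bottom; that is, $y_{11}>y_{21}>\cdots>y_{(mn)1}>y_{(m+1)2}>\cdots>y_{(2m)2}>y_{12}>\cdots>y_{(mn)2}>\cdots>y_{(m(n-1)+1)n}>\cdots>y_{(mn)n}>y_{1n}>\cdots>y_{(m(n-1))n}$; and $x_{11}>x_{12}>\cdots>x_{m(mn)}$ (row by row). For $1\le s\le n$ let $\mathcal{G}_s$ be the reduced Gröbner basis of the ideal $I_1([X]_s[Y]_s)$ described in the context. Then for every $1\le t\le n$ the set $\mathfrak{G}_t=\bigcup_{s=1}^{t}\mathcal{G}_s$ is a reduced Gröbner basis of the ideal $P_t=\sum_{s=1}^{t}I_1([X]_s[Y]_s)$. In particular, $\mathfrak{G}_n$ is a reduced Gröbner basis of $P_n=I_1(XY)$.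
   Context: $I_1(M)$ denotes the ideal generated by the entries of a matrix $M$. Write $X=\begin{pmatrix}A_1&\cdots&A_n\end{pmatrix}$, where $A_s$ is the $m\times m$ block of $X$ consisting of columns $m(s-1)+1,\dots,ms$. For $1\le s\le n$ put $[X]_s=\begin{pmatrix}A_s&A_1&\cdots&\widehat{A_s}&\cdots&A_n\end{pmatrix}$ (the block $A_s$ is moved to the front, the other blocks keep their order), an $m\times mn$ matrix. $[Y]_s$ is the column matrix of length $mn$ obtained from the $s$-th column of $Y$ by moving the entries $y_{(m(s-1)+1)s},\dots,y_{(ms)s}$ to the top, the other entries $y_{1s},\dots,y_{(mn)s}$ following in their original order; so the entries of $[X]_s[Y]_s$ are the entries of the $s$-th column of $XY$. The set $\mathcal{G}_s$ is the following: for $1\le k\le m$ and $1\le a_1<\cdots<a_k\le m$, let $f_{s,\mathbf{a}}=\sum_{p=k}^{mn}[a_1,\dots,a_k\mid 1,\dots,k-1,p]_s\,([Y]_s)_p$, where $[a_1,\dots,a_k\mid b_1,\dots,b_k]_s$ is the minor of $[X]_s$ with rows $a_1,\dots,a_k$ and columns $b_1,\dots,b_k$ (columns numbered as in $[X]_s$), and $([Y]_s)_p$ is the $p$-th entry of $[Y]_s$; then $\mathcal{G}_s=\{f_{s,\mathbf{a}}\}$ over all such $k$ and $\mathbf{a}=(a_1,\dots,a_k)$. *)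

theory Defs
  imports
    "HOL-Library.Poly_Mapping"
    "HOL-Algebra.Ideal"
    "Jordan_Normal_Form.Determinant"
begin

text \<open>
  All row, column and block indices are counted from 0, as in the matrix library.
  \<open>XV i j\<close> and \<open>YV k l\<close> are the entries of \<open>X\<close> and \<open>Y\<close> in the given row and column.
\<close>

datatype var = XV nat nat | YV nat nat

type_synonym monom = "var \<Rightarrow>\<^sub>0 nat"
type_synonym 'k mpoly = "monom \<Rightarrow>\<^sub>0 'k"

definition vars_R :: "nat \<Rightarrow> nat \<Rightarrow> var set" where
  "vars_R m n = {XV i j | i j. i < m \<and> j < m * n} \<union> {YV k l | k l. k < m * n \<and> l < n}"

text \<open>
  The type \<open>var\<close> has infinitely many elements, so \<open>R\<close> is the set of those polynomials in
  which only the finitely many entries of \<open>X\<close> and \<open>Y\<close> occur; ideals are ideals of this ring.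
\<close>

definition poly_R :: "nat \<Rightarrow> nat \<Rightarrow> ('k::field) mpoly ring" where
  "poly_R m n =
     \<lparr>carrier = {p. \<forall>\<mu>\<in>Poly_Mapping.keys p. Poly_Mapping.keys \<mu> \<subseteq> vars_R m n},
      monoid.mult = (*), one = 1, zero = 0, add = (+)\<rparr>"

definition Var :: "var \<Rightarrow> ('k::field) mpoly" where
  "Var v = Poly_Mapping.single (Poly_Mapping.single v 1) 1"

definition mat_X :: "nat \<Rightarrow> nat \<Rightarrow> ('k::field) mpoly mat" where
  "mat_X m n = mat m (m * n) (\<lambda>(i, j). Var (XV i j))"

definition mat_Y :: "nat \<Rightarrow> nat \<Rightarrow> ('k::field) mpoly mat" where
  "mat_Y m n = mat (m * n) n (\<lambda>(k, l). Var (YV k l))"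

text \<open>
  \<open>front m s p\<close> is the original index of what stands at position \<open>p\<close> once the
  block \<open>s\<close>, i.e. the indices \<open>m * s, \<dots>, m * s + m - 1\<close>, has been moved to the front.
\<close>

definition front :: "nat \<Rightarrow> nat \<Rightarrow> nat \<Rightarrow> nat" where
  "front m s p = (if p < m then m * s + p else if p < m * (s + 1) then p - m else p)"

definition X_at :: "nat \<Rightarrow> nat \<Rightarrow> nat \<Rightarrow> ('k::field) mpoly mat" where
  "X_at m n s = mat m (m * n) (\<lambda>(i, p). mat_X m n $$ (i, front m s p))"

definition Y_at :: "nat \<Rightarrow> nat \<Rightarrow> nat \<Rightarrow> ('k::field) mpoly mat" where
  "Y_at m n s = mat (m * n) 1 (\<lambda>(p, _). mat_Y m n $$ (front m s p, s))"

definition I1 :: "nat \<Rightarrow> nat \<Rightarrow> ('k::field) mpoly mat \<Rightarrow> 'k mpoly set" where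
  "I1 m n A = genideal (poly_R m n) (elements_mat A)"

text \<open>The minor with the listed rows \<open>as\<close> and the listed columns \<open>bs\<close>.\<close>

definition minor :: "'a::comm_ring_1 mat \<Rightarrow> nat list \<Rightarrow> nat list \<Rightarrow> 'a" where
  "minor A as bs = det (mat (length as) (length bs) (\<lambda>(i, j). A $$ (as ! i, bs ! j)))"

text \<open>
  With \<open>k = length as\<close>, the columns \<open>1, \<dots>, k - 1, p\<close> with \<open>k \<le> p \<le> mn\<close> become
  \<open>0, \<dots>, k - 2, p\<close> with \<open>k - 1 \<le> p < mn\<close>.
\<close>

definition f_poly :: "nat \<Rightarrow> nat \<Rightarrow> nat \<Rightarrow> nat list \<Rightarrow> ('k::field) mpoly" where
  "f_poly m n s as =
     (\<Sum>p = length as - 1..<m * n.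
        minor (X_at m n s) as ([0..<length as - 1] @ [p]) * Y_at m n s $$ (p, 0))"

definition G_set :: "nat \<Rightarrow> nat \<Rightarrow> nat \<Rightarrow> ('k::field) mpoly set" where
  "G_set m n s =
     {f_poly m n s as | as k. 1 \<le> k \<and> k \<le> m \<and> length as = k \<and>
                              sorted_wrt (<) as \<and> set as \<subseteq> {..<m}}"

definition P_ideal :: "nat \<Rightarrow> nat \<Rightarrow> nat \<Rightarrow> ('k::field) mpoly set" where
  "P_ideal m n t =
     {\<Sum>s<t. g s | g. \<forall>s<t. g s \<in> I1 m n (X_at m n s * Y_at m n s)}"

text \<open>
  \<open>var_gt m v w\<close> means \<open>v > w\<close>.  In the third rule, \<open>YV (front m s p) s\<close> is the entry of
  the column \<open>s\<close> of \<open>Y\<close> that stands at position \<open>p\<close> after the rearrangement.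
\<close>

inductive var_gt :: "nat \<Rightarrow> var \<Rightarrow> var \<Rightarrow> bool" for m :: nat where
  "var_gt m (YV k l) (XV i j)"
| "s < s' \<Longrightarrow> var_gt m (YV k s) (YV l s')"
| "p < q \<Longrightarrow> var_gt m (YV (front m s p) s) (YV (front m s q) s)"
| "i < i' \<Longrightarrow> var_gt m (XV i j) (XV i' j')"
| "j < j' \<Longrightarrow> var_gt m (XV i j) (XV i j')"

definition lex_less :: "nat \<Rightarrow> monom \<Rightarrow> monom \<Rightarrow> bool" where
  "lex_less m \<mu> \<nu> \<longleftrightarrow>
     (\<exists>v. Poly_Mapping.lookup \<mu> v < Poly_Mapping.lookup \<nu> v \<and>
          (\<forall>w. var_gt m w v \<longrightarrow> Poly_Mapping.lookup \<mu> w = Poly_Mapping.lookup \<nu> w))"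

text \<open>Leading monomial and leading coefficient are only meaningful for nonzero polynomials.\<close>

definition lead_mon :: "nat \<Rightarrow> ('k::field) mpoly \<Rightarrow> monom" where
  "lead_mon m p =
     (THE \<mu>. \<mu> \<in> Poly_Mapping.keys p \<and> (\<forall>\<nu>\<in>Poly_Mapping.keys p. \<nu> \<noteq> \<mu> \<longrightarrow> lex_less m \<nu> \<mu>))"

definition lead_coef :: "nat \<Rightarrow> ('k::field) mpoly \<Rightarrow> 'k" where
  "lead_coef m p = Poly_Mapping.lookup p (lead_mon m p)"

definition mon_dvd :: "monom \<Rightarrow> monom \<Rightarrow> bool" where
  "mon_dvd \<mu> \<nu> \<longleftrightarrow> (\<forall>v. Poly_Mapping.lookup \<mu> v \<le> Poly_Mapping.lookup \<nu> v)"

definition initial_ideal :: "nat \<Rightarrow> nat \<Rightarrow> ('k::field) mpoly set \<Rightarrow> 'k mpoly set" where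
  "initial_ideal m n F =
     genideal (poly_R m n) {Poly_Mapping.single (lead_mon m f) 1 | f. f \<in> F \<and> f \<noteq> 0}"

definition is_groebner_basis ::
    "nat \<Rightarrow> nat \<Rightarrow> ('k::field) mpoly set \<Rightarrow> 'k mpoly set \<Rightarrow> bool" where
  "is_groebner_basis m n G I \<longleftrightarrow>
     finite G \<and> G \<subseteq> I \<and> 0 \<notin> G \<and> initial_ideal m n G = initial_ideal m n I"

definition is_reduced_groebner_basis ::
    "nat \<Rightarrow> nat \<Rightarrow> ('k::field) mpoly set \<Rightarrow> 'k mpoly set \<Rightarrow> bool" where
  "is_reduced_groebner_basis m n G I \<longleftrightarrow>
     is_groebner_basis m n G I \<and>
     (\<forall>g\<in>G. lead_coef m g = 1 \<and>
        (\<forall>h\<in>G - {g}. \<forall>\<mu>\<in>Poly_Mapping.keys g. \<not> mon_dvd (lead_mon m h) \<mu>))"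

end

theory Submission
  imports Defs
begin

text \<open>
  Fix a set of columns of \<open>Y\<close>, and write \<open>g\<^sub>i\<close> for the entries of \<open>[X]\<^sub>s [Y]\<^sub>s\<close>.  The generator \<open>f\<close> with
  rows \<open>a\<^sub>1 < \<dots> < a\<^sub>k\<close> is the determinant of these rows of the first \<open>k - 1\<close> columns of \<open>[X]\<^sub>s\<close>, followed by
  the column of the \<open>g\<^sub>i\<close> (\<open>f_poly_eq_f_aug\<close>).  So it lies in the ideal, and for \<open>k = 1\<close> it is one of the
  \<open>g\<^sub>i\<close>.  Its leading monomial is the diagonal of the rows \<open>a\<^sub>1, \<dots>, a\<^sub>k\<close> and the first \<open>k\<close> columns,
  times the \<open>k\<close>-th entry of \<open>[Y]\<^sub>s\<close> (\<open>is_lead_f_poly\<close>).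

  The ideal is the span, over the field, of all products of a monomial with a generator.  These
  multiples are ordered by the leading monomial, then by \<open>s\<close>, by \<open>k\<close> and by the sum of the rows
  (\<open>lower\<close>).  A multiple is called reducible if it is a combination of lower ones.  The order is
  well-founded, so the irreducible multiples still span the ideal.  The point is that of two
  different multiples with the same leading monomial at least one is reducible
  (\<open>reducible_if_same_lead\<close>).  Three identities give this:

  \<^item> for different columns \<open>s\<close> the leading monomials are coprime, and the product of the two
    generators can be expanded in two ways (\<open>reducible_coprime\<close>);

  \<^item> for the same column and different sizes, the smaller size \<open>j\<close> forces the \<open>j\<close>-th entry of \<open>[Y]\<^sub>s\<close>
    into the cofactor of the larger generator; replacing the \<open>j\<close>-th column of that determinant by
    the column of the \<open>g\<^sub>i\<close> makes it vanish, and linearity yields the relation (\<open>reducible_y\<close>);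

  \<^item> for the same column and size, take the first place where the two row lists differ; the smaller
    of the two rows is inserted into the other list, and the enlarged determinant is expanded along
    one more column (\<open>reducible_row\<close>).

  Hence the irreducible multiples have pairwise different leading monomials, nothing cancels in a
  combination of them (\<open>span_lead\<close>), and the leading monomial of any element of the ideal is a multiple
  of the leading monomial of a generator.  That is the Groebner property, for a single column as
  well as for any set of columns.  The basis is reduced because the monomials of a generator
  determine its column and bound its size and its rows (\<open>lead_not_dvd_key\<close>).
\<close>

section \<open>The order of the variables and of the monomials\<close>

lemma front_lt_block [simp]: "p < m \<Longrightarrow> front m s p = m * s + p"
  by (simp add: front_def)

lemma front_inj: "inj (front m s)"
proof (rule injI)
  fix p q assume "front m s p = front m s q"
  then show "p = q" by (auto simp: front_def split: if_splits)
qed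

lemma front_eq_iff [simp]: "front m s p = front m s q \<longleftrightarrow> p = q"
  using front_inj by (auto dest: injD)

text \<open>
  With \<open>front_inj\<close>: moving a block to the front permutes the indices.
\<close>

lemma front_surj:
  obtains p where "front m s p = k"
proof -
  consider "k < m * s" | "m * s \<le> k" "k < m * s + m" | "m * s + m \<le> k" by linarith
  then show ?thesis
  proof cases
    case 1 then show ?thesis by (intro that[of "k + m"]) (simp add: front_def)
  next
    case 2 then show ?thesis by (intro that[of "k - m * s"]) (simp add: front_def)
  next
    case 3 then show ?thesis by (intro that[of k]) (auto simp: front_def)
  qed
qed

lemma front_less:
  assumes "s < n"
  shows "front m s p < m * n \<longleftrightarrow> p < m * n"
proof -
  have "m * s + m \<le> m * n" using assms by (metis Suc_leI mult_Suc_right add.commute mult_le_mono2)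
  then show ?thesis by (auto simp: front_def)
qed

lemma front_bij: "s < n \<Longrightarrow> bij_betw (front m s) {..<m * n} {..<m * n}"
proof (rule bij_betwI')
  fix k assume s: "s < n" and k: "k \<in> {..<m * n}"
  obtain p where "front m s p = k" using front_surj .
  with s k show "\<exists>p\<in>{..<m * n}. k = front m s p" by (auto simp: front_less intro!: bexI[of _ p])
qed (simp_all add: front_less)

text \<open>
  The lexicographic order of triples is linear; the order of the variables is its restriction to
  these triples, a smaller triple belonging to a larger variable.
\<close>

definition var_key :: "nat \<Rightarrow> var \<Rightarrow> nat \<times> nat \<times> nat" where
  "var_key m v = (case v of YV k l \<Rightarrow> (0, l, the_inv (front m l) k) | XV i j \<Rightarrow> (1, i, j))"

lemma the_inv_front [simp]: "the_inv (front m l) (front m l p) = p"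
  by (rule the_inv_f_f[OF front_inj])

lemma front_the_inv [simp]: "front m l (the_inv (front m l) k) = k"
  by (metis front_surj the_inv_front)

lemma var_gt_iff: "var_gt m w v \<longleftrightarrow> (var_key m w, var_key m v) \<in> less_than <*lex*> less_than <*lex*> less_than"
proof
  show "var_gt m w v \<Longrightarrow> (var_key m w, var_key m v) \<in> less_than <*lex*> less_than <*lex*> less_than"
    by (induction rule: var_gt.induct) (auto simp: var_key_def)
next
  assume r: "(var_key m w, var_key m v) \<in> less_than <*lex*> less_than <*lex*> less_than"
  show "var_gt m w v"
  proof (cases w; cases v)
    fix k l k' l' assume w: "w = YV k l" and v: "v = YV k' l'"
    show ?thesis
    proof (cases "l < l'")
      case True then show ?thesis using w v by (auto intro: var_gt.intros)
    next
      case False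
      then have "l = l'" "the_inv (front m l) k < the_inv (front m l) k'" using r w v by (auto simp: var_key_def)
      then show ?thesis using w v var_gt.intros(3)[of "the_inv (front m l) k" "the_inv (front m l) k'" m l] by simp
    qed
  qed (use r in \<open>auto simp: var_key_def intro: var_gt.intros\<close>)
qed

lemma var_key_inj: "var_key m v = var_key m w \<Longrightarrow> v = w"
  by (auto simp: var_key_def split: var.splits) (metis front_the_inv)

lemma var_gt_irrefl: "\<not> var_gt m v v"
  by (cases "var_key m v") (simp add: var_gt_iff)

lemma var_gt_trans: "var_gt m u v \<Longrightarrow> var_gt m v w \<Longrightarrow> var_gt m u w"
  unfolding var_gt_iff by (auto simp: lex_prod_def)

lemma var_gt_total: "v \<noteq> w \<Longrightarrow> var_gt m v w \<or> var_gt m w v"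
proof -
  assume "v \<noteq> w"
  then have "var_key m v \<noteq> var_key m w" using var_key_inj by blast
  then show ?thesis unfolding var_gt_iff by (cases "var_key m v"; cases "var_key m w") auto
qed

lemma var_gt_Y_iff: "var_gt m (YV (front m s p) s) (YV (front m s q) s) \<longleftrightarrow> p < q"
  by (simp add: var_gt_iff var_key_def)

lemma var_gt_X_iff: "var_gt m (XV i j) (XV i' j') \<longleftrightarrow> i < i' \<or> (i = i' \<and> j < j')"
  by (simp add: var_gt_iff var_key_def)

lemma not_var_gt_X_Y: "\<not> var_gt m (XV i j) (YV k l)"
  by (simp add: var_gt_iff var_key_def)

text \<open>
  Listing finitely many variables from the largest down turns statements about the first variable
  in which two monomials differ into statements about lists.
\<close>

lemma sorted_vars_exist:
  assumes "finite S"
  obtains vs where "set vs = S" "sorted_wrt (var_gt m) vs"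
proof -
  have "\<exists>vs. set vs = S \<and> sorted_wrt (var_gt m) vs"
    using assms
  proof (induction S rule: finite_psubset_induct)
    case (psubset S)
    show ?case
    proof (cases "S = {}")
      case False
      then have "\<exists>v\<in>S. \<forall>w. var_gt m w v \<longrightarrow> w \<notin> S"
        using wf_eq_minimal[THEN iffD1, rule_format, of "less_than <*lex*> less_than <*lex*> less_than"
            _ "var_key m ` S"]
        by (fastforce simp: var_gt_iff)
      then obtain v where v: "v \<in> S" "\<And>w. w \<in> S \<Longrightarrow> w \<noteq> v \<Longrightarrow> var_gt m v w"
        using var_gt_total by metis
      obtain vs where "set vs = S - {v}" "sorted_wrt (var_gt m) vs"
        using psubset.IH[of "S - {v}"] v by auto
      with v show ?thesis by (intro exI[of _ "v # vs"]) auto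
    qed auto
  qed
  with that show ?thesis by blast
qed

lemma lex_less_irrefl: "\<not> lex_less m \<mu> \<mu>"
  by (simp add: lex_less_def)

lemma lex_less_trans:
  assumes "lex_less m \<mu> \<nu>" "lex_less m \<nu> \<rho>"
  shows "lex_less m \<mu> \<rho>"
proof -
  obtain v where v: "Poly_Mapping.lookup \<mu> v < Poly_Mapping.lookup \<nu> v"
    "\<And>w. var_gt m w v \<Longrightarrow> Poly_Mapping.lookup \<mu> w = Poly_Mapping.lookup \<nu> w"
    using assms(1) by (auto simp: lex_less_def)
  obtain v' where v': "Poly_Mapping.lookup \<nu> v' < Poly_Mapping.lookup \<rho> v'"
    "\<And>w. var_gt m w v' \<Longrightarrow> Poly_Mapping.lookup \<nu> w = Poly_Mapping.lookup \<rho> w"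
    using assms(2) by (auto simp: lex_less_def)
  consider "v = v'" | "var_gt m v v'" | "var_gt m v' v" using var_gt_total by blast
  then show ?thesis unfolding lex_less_def
  proof cases
    case 1 with v v' show "\<exists>v. Poly_Mapping.lookup \<mu> v < Poly_Mapping.lookup \<rho> v \<and>
      (\<forall>w. var_gt m w v \<longrightarrow> Poly_Mapping.lookup \<mu> w = Poly_Mapping.lookup \<rho> w)"
      by (intro exI[of _ v]) auto
  next
    case 2 with v v' show "\<exists>v. Poly_Mapping.lookup \<mu> v < Poly_Mapping.lookup \<rho> v \<and>
      (\<forall>w. var_gt m w v \<longrightarrow> Poly_Mapping.lookup \<mu> w = Poly_Mapping.lookup \<rho> w)"
      by (intro exI[of _ v]) (metis var_gt_trans)
  next
    case 3 with v v' show "\<exists>v. Poly_Mapping.lookup \<mu> v < Poly_Mapping.lookup \<rho> v \<and>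
      (\<forall>w. var_gt m w v \<longrightarrow> Poly_Mapping.lookup \<mu> w = Poly_Mapping.lookup \<rho> w)"
      by (intro exI[of _ v']) (metis var_gt_trans)
  qed
qed

lemma lex_less_total:
  assumes "\<mu> \<noteq> \<nu>"
  shows "lex_less m \<mu> \<nu> \<or> lex_less m \<nu> \<mu>"
proof -
  let ?S = "{v. Poly_Mapping.lookup \<mu> v \<noteq> Poly_Mapping.lookup \<nu> v}"
  have "?S \<subseteq> Poly_Mapping.keys \<mu> \<union> Poly_Mapping.keys \<nu>" by (auto simp: in_keys_iff)
  then have "finite ?S" by (rule finite_subset) simp
  then obtain vs where vs: "set vs = ?S" "sorted_wrt (var_gt m) vs" by (rule sorted_vars_exist)
  have "?S \<noteq> {}" using assms by (auto intro: poly_mapping_eqI)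
  then obtain v ws where "vs = v # ws" using vs by (cases vs) auto
  with vs have v: "v \<in> ?S" "\<And>w. w \<in> ?S \<Longrightarrow> w \<noteq> v \<Longrightarrow> var_gt m v w" by auto
  then have "\<forall>w. var_gt m w v \<longrightarrow> Poly_Mapping.lookup \<mu> w = Poly_Mapping.lookup \<nu> w"
    using var_gt_irrefl var_gt_trans by (metis (mono_tags, lifting) mem_Collect_eq)
  with v(1) show ?thesis unfolding lex_less_def by (metis (mono_tags, lifting) linorder_neqE_nat mem_Collect_eq)
qed

lemma lex_less_add: "lex_less m (\<rho> + \<mu>) (\<rho> + \<nu>) \<longleftrightarrow> lex_less m \<mu> \<nu>"
  by (simp add: lex_less_def lookup_add)

lemma lex_less_add_right: "lex_less m (\<mu> + \<rho>) (\<nu> + \<rho>) \<longleftrightarrow> lex_less m \<mu> \<nu>"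
  by (simp add: lex_less_def lookup_add)

text \<open>
  On monomials in a fixed finite set of variables the order is a comparison of exponent lists of
  one length, and the lexicographic order of lists of one length is well-founded.  With infinitely
  many variables it is not.
\<close>

lemma lex_less_imp_lex:
  assumes vs: "sorted_wrt (var_gt m) vs"
    and "Poly_Mapping.keys \<mu> \<subseteq> set vs" "Poly_Mapping.keys \<nu> \<subseteq> set vs" "lex_less m \<mu> \<nu>"
  shows "(map (Poly_Mapping.lookup \<mu>) vs, map (Poly_Mapping.lookup \<nu>) vs) \<in> lex less_than"
proof -
  obtain v where v: "Poly_Mapping.lookup \<mu> v < Poly_Mapping.lookup \<nu> v"
    "\<And>w. var_gt m w v \<Longrightarrow> Poly_Mapping.lookup \<mu> w = Poly_Mapping.lookup \<nu> w"
    using assms(4) by (auto simp: lex_less_def)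
  then have "v \<in> Poly_Mapping.keys \<nu>" by (simp add: in_keys_iff)
  then obtain ws us where "vs = ws @ v # us" using assms(3) by (meson split_list subsetD)
  moreover from this have "map (Poly_Mapping.lookup \<mu>) ws = map (Poly_Mapping.lookup \<nu>) ws"
    using vs v(2) by (auto simp: sorted_wrt_append)
  ultimately show ?thesis using v(1)
    by (auto simp: lex_conv intro!: exI[of _ "map (Poly_Mapping.lookup \<nu>) ws"])
qed

section \<open>Deleting and inserting list entries\<close>

definition delete_at :: "nat \<Rightarrow> 'a list \<Rightarrow> 'a list" where
  "delete_at l as = take l as @ drop (Suc l) as"

definition insert_at :: "nat \<Rightarrow> 'a \<Rightarrow> 'a list \<Rightarrow> 'a list" where
  "insert_at l c as = take l as @ c # drop l as"

lemma length_delete_at [simp]: "l < length as \<Longrightarrow> length (delete_at l as) = length as - 1"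
  by (simp add: delete_at_def)

lemma nth_delete_at:
  "l < length as \<Longrightarrow> i < length as - 1 \<Longrightarrow> delete_at l as ! i = as ! (if i < l then i else Suc i)"
  by (auto simp: delete_at_def nth_append min_def)

lemma set_delete_at: "set (delete_at l as) \<subseteq> set as"
  by (auto simp: delete_at_def dest: in_set_takeD in_set_dropD)

lemma sorted_delete_at: "sorted_wrt (<) as \<Longrightarrow> sorted_wrt (<) (delete_at l (as::nat list))"
proof -
  assume s: "sorted_wrt (<) as"
  then have "sorted_wrt (<) (take l as @ drop l as)" by simp
  then have "\<forall>x\<in>set (take l as). \<forall>y\<in>set (drop l as). x < y" unfolding sorted_wrt_append by blast
  moreover have "set (drop (Suc l) as) \<subseteq> set (drop l as)" by (rule set_drop_subset_set_drop) simp
  ultimately show ?thesis using s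
    unfolding delete_at_def sorted_wrt_append by (meson sorted_wrt_drop sorted_wrt_take subsetD)
qed

lemma length_insert_at [simp]: "length (insert_at l c as) = Suc (length as)"
  by (simp add: insert_at_def)

lemma delete_at_insert_at [simp]: "l \<le> length as \<Longrightarrow> delete_at l (insert_at l c as) = as"
  by (simp add: delete_at_def insert_at_def)

lemma set_insert_at [simp]: "set (insert_at l c as) = insert c (set as)"
  by (simp add: insert_at_def) (metis append_take_drop_id set_append)

lemma mset_insert_at [simp]: "mset (insert_at l c as) = add_mset c (mset as)"
  by (simp add: insert_at_def) (metis append_take_drop_id mset_append)

lemma nth_insert_at:
  "l \<le> length as \<Longrightarrow> i \<le> length as \<Longrightarrow>
   insert_at l c as ! i = (if i < l then as ! i else if i = l then c else as ! (i - 1))"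
proof -
  assume "l \<le> length as" "i \<le> length as"
  moreover have "l + (i - Suc l) = i - 1" if "l < i" using that by simp
  ultimately show ?thesis by (auto simp: insert_at_def nth_append nth_Cons')
qed

lemma sorted_insert_at:
  assumes "sorted_wrt (<) as" "j < length as" "i < as ! j" "j > 0 \<Longrightarrow> as ! (j - 1) < (i::nat)"
  shows "sorted_wrt (<) (insert_at j i as)"
proof -
  have "x < i" if x: "x \<in> set (take j as)" for x
  proof -
    obtain l where l: "l < j" "x = as ! l" using x by (auto simp: in_set_conv_nth)
    then have "as ! l \<le> as ! (j - 1)"
      using assms(1,2) by (cases "l = j - 1") (auto simp: sorted_wrt_iff_nth_less intro!: less_imp_le)
    then show ?thesis using assms(4) l by simp
  qed
  moreover have "i < x" if x: "x \<in> set (drop j as)" for x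
  proof -
    obtain l where "l < length as - j" "x = as ! (j + l)" using x by (auto simp: in_set_conv_nth)
    then have l: "j + l < length as" "x = as ! (j + l)" by auto
    then have "as ! j \<le> as ! (j + l)"
      using assms(1,2) by (cases "l = 0") (auto simp: sorted_wrt_iff_nth_less intro!: less_imp_le)
    then show ?thesis using assms(3) l by simp
  qed
  moreover have "sorted_wrt (<) (take j as @ drop j as)" using assms(1) by simp
  ultimately show ?thesis unfolding insert_at_def sorted_wrt_append by (auto intro: less_trans)
qed

lemma sum_list_delete_at: "l < length as \<Longrightarrow> sum_list (delete_at l as) + as ! l = sum_list (as :: nat list)"
proof -
  assume "l < length as"
  then have "sum_list as = sum_list (take l as @ as ! l # drop (Suc l) as)" by (simp add: id_take_nth_drop[symmetric])
  then show ?thesis by (simp add: delete_at_def)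
qed

section \<open>Determinants with one special column\<close>

text \<open>
  The cofactors along a column do not see that column, so expanding along it shows linearity.
\<close>

lemma det_sum_column:
  fixes v :: "'b \<Rightarrow> nat \<Rightarrow> 'a::comm_ring_1"
  assumes j: "j < k"
  shows "det (mat k k (\<lambda>(i, j'). if j' = j then (\<Sum>p\<in>P. c p * v p i) else w i j')) =
         (\<Sum>p\<in>P. c p * det (mat k k (\<lambda>(i, j'). if j' = j then v p i else w i j')))"
proof -
  define M where "M u = mat k k (\<lambda>(i, j'). if j' = j then u i else w i j')" for u :: "nat \<Rightarrow> 'a"
  have carrier: "M u \<in> carrier_mat k k" for u by (simp add: M_def)
  have cof: "cofactor (M u) i j = cofactor (M (\<lambda>_. 0)) i j" if "i < k" for u i
  proof -
    have "mat_delete (M u) i j = mat_delete (M (\<lambda>_. 0)) i j"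
      by (rule eq_matI) (auto simp: M_def mat_delete_def)
    then show ?thesis by (simp add: cofactor_def)
  qed
  have expand: "det (M u) = (\<Sum>i<k. u i * cofactor (M (\<lambda>_. 0)) i j)" for u
    unfolding laplace_expansion_column[OF carrier j, of u]
    by (rule sum.cong) (simp_all add: cof[of _ u], simp add: M_def j)
  have "det (M (\<lambda>i. \<Sum>p\<in>P. c p * v p i)) = (\<Sum>p\<in>P. c p * det (M (v p)))"
    unfolding expand sum_distrib_right sum_distrib_left
    by (subst sum.swap) (simp add: mult.assoc)
  then show ?thesis by (simp add: M_def)
qed

text \<open>
  The rows \<open>as\<close> of the matrix made of the columns \<open>cs\<close> of \<open>\<xi>\<close>, followed by the special column
  \<open>g\<close>.  This is meant for \<open>length as = Suc (length cs)\<close>, so that \<open>g\<close> occurs exactly once.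
\<close>

definition aug_det :: "(nat \<Rightarrow> nat \<Rightarrow> 'a::comm_ring_1) \<Rightarrow> (nat \<Rightarrow> 'a) \<Rightarrow> nat list \<Rightarrow> nat list \<Rightarrow> 'a" where
  "aug_det \<xi> g as cs =
     det (mat (length as) (length as)
       (\<lambda>(i, j). if j < length cs then \<xi> (as ! i) (cs ! j) else g (as ! i)))"

lemma aug_det_repeat:
  assumes "length as = Suc (length cs)" "i < length cs" "j < length cs" "i \<noteq> j" "cs ! i = cs ! j"
  shows "aug_det \<xi> g as cs = 0"
  unfolding aug_det_def
  by (rule det_identical_columns[of _ "length as" i j]) (use assms in \<open>auto intro!: eq_vecI\<close>)

text \<open>Laplace expansion along the last of the ordinary columns.\<close>

lemma aug_det_expand:
  assumes len: "length as = Suc (Suc (length cs))"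
  shows "aug_det \<xi> g as (cs @ [c]) =
    (\<Sum>l<length as. (-1) ^ (l + length cs) * (\<xi> (as ! l) c * aug_det \<xi> g (delete_at l as) cs))"
proof -
  define M where "M = mat (length as) (length as)
       (\<lambda>(i, j). if j < length (cs @ [c]) then \<xi> (as ! i) ((cs @ [c]) ! j) else g (as ! i))"
  have del: "mat_delete M l (length cs) =
     mat (length (delete_at l as)) (length (delete_at l as))
       (\<lambda>(i, j). if j < length cs then \<xi> (delete_at l as ! i) (cs ! j) else g (delete_at l as ! i))"
    if l: "l < length as" for l
    by (rule eq_matI) (use l len in \<open>auto simp: M_def mat_delete_def nth_delete_at nth_append\<close>)
  have "M \<in> carrier_mat (length as) (length as)" "length cs < length as" using len by (simp_all add: M_def)
  from laplace_expansion_column[OF this]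
  have "det M = (\<Sum>l<length as. M $$ (l, length cs) * cofactor M l (length cs))" .
  also have "\<dots> = (\<Sum>l<length as. (-1) ^ (l + length cs) * (\<xi> (as ! l) c * aug_det \<xi> g (delete_at l as) cs))"
    by (rule sum.cong) (use len in \<open>simp_all add: M_def[symmetric] cofactor_def del aug_det_def, simp add: M_def\<close>)
  finally show ?thesis by (simp add: aug_det_def M_def)
qed

text \<open>
  The special column is a combination of the ordinary ones, and those ordinary columns that are
  already present do not contribute.
\<close>

lemma aug_det_eq_sum:
  assumes g: "\<And>i. g i = (\<Sum>p<N. \<xi> i p * \<eta> p)" and len: "length as = Suc k" and k: "k \<le> N"
  shows "aug_det \<xi> g as [0..<k] =
    (\<Sum>p = k..<N. det (mat (Suc k) (Suc k) (\<lambda>(i, j). \<xi> (as ! i) (([0..<k] @ [p]) ! j))) * \<eta> p)"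
proof -
  define M where "M p = det (mat (Suc k) (Suc k) (\<lambda>(i, j). \<xi> (as ! i) (([0..<k] @ [p]) ! j)))" for p
  have M: "M p = det (mat (Suc k) (Suc k) (\<lambda>(i, j). if j = k then \<xi> (as ! i) p else \<xi> (as ! i) j))" for p
    unfolding M_def by (rule arg_cong[of _ _ det], rule eq_matI) (auto simp: nth_append)
  have zero: "M p = 0" if "p < k" for p
    unfolding M by (rule det_identical_columns[of _ "Suc k" p k]) (use that in \<open>auto intro!: eq_vecI\<close>)
  have "aug_det \<xi> g as [0..<k] =
    det (mat (Suc k) (Suc k) (\<lambda>(i, j). if j = k then (\<Sum>p<N. \<eta> p * \<xi> (as ! i) p) else \<xi> (as ! i) j))"
    unfolding aug_det_def
    by (rule arg_cong[of _ _ det], rule eq_matI) (auto simp: len g mult.commute)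
  also have "\<dots> = (\<Sum>p<N. \<eta> p * M p)"
    by (subst det_sum_column) (simp_all add: M)
  also have "\<dots> = (\<Sum>p = k..<N. M p * \<eta> p)"
    by (rule sum.mono_neutral_cong_right) (use zero in \<open>auto simp: mult.commute not_less\<close>)
  finally show ?thesis by (simp add: M_def)
qed

text \<open>
  Replacing the ordinary column \<open>j\<close> by the special column makes the determinant vanish.
  Linearity in that column expresses \<open>\<eta> j\<close> times the determinant by the columns from \<open>k\<close> on.
\<close>

lemma mult_aug_det:
  assumes g: "\<And>i. g i = (\<Sum>p<N. \<xi> i p * \<eta> p)" and len: "length as = Suc k" and j: "j < k" and k: "k \<le> N"
  shows "\<eta> j * aug_det \<xi> g as [0..<k] =
    - (\<Sum>p = k..<N. \<eta> p * aug_det \<xi> g as ([0..<j] @ p # [Suc j..<k]))"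
proof -
  define w where "w i j' = (if j' < k then \<xi> (as ! i) j' else g (as ! i))" for i j'
  define M where "M v = det (mat (Suc k) (Suc k) (\<lambda>(i, j'). if j' = j then v i else w i j'))" for v
  have nth: "([0..<j] @ p # [Suc j..<k]) ! i = (if i = j then p else i)" if "i < k" for p i
    using that j by (auto simp: nth_append nth_Cons split: nat.splits)
  have M: "M (\<lambda>i. \<xi> (as ! i) p) = aug_det \<xi> g as ([0..<j] @ p # [Suc j..<k])" for p
    unfolding M_def aug_det_def
    by (rule arg_cong[of _ _ det], rule eq_matI) (use j in \<open>auto simp: len w_def nth\<close>)
  have zero: "M (\<lambda>i. \<xi> (as ! i) p) = 0" if "p < k" "p \<noteq> j" for p
    unfolding M by (rule aug_det_repeat[of _ _ p j]) (use that j in \<open>auto simp: len nth\<close>)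
  have upt: "[0..<j] @ j # [Suc j..<k] = [0..<k]"
  proof -
    have "[0..<j + (k - j)] = [0..<j] @ [j..<j + (k - j)]" by (rule upt_add_eq_append) simp
    then show ?thesis using j upt_conv_Cons[OF j] by auto
  qed
  have "0 = M (\<lambda>i. g (as ! i))"
    unfolding M_def
    by (rule sym, rule det_identical_columns[of _ "Suc k" j k]) (use j in \<open>auto simp: w_def intro!: eq_vecI\<close>)
  also have "\<dots> = (\<Sum>p<N. \<eta> p * M (\<lambda>i. \<xi> (as ! i) p))"
    using j unfolding M_def g mult.commute[of "\<xi> _ _"] by (subst det_sum_column) simp_all
  also have "\<dots> = (\<Sum>p\<in>insert j {k..<N}. \<eta> p * M (\<lambda>i. \<xi> (as ! i) p))"
  proof (rule sum.mono_neutral_right)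
    show "\<forall>p\<in>{..<N} - insert j {k..<N}. \<eta> p * M (\<lambda>i. \<xi> (as ! i) p) = 0"
    proof
      fix p assume "p \<in> {..<N} - insert j {k..<N}"
      then have "p < k" "p \<noteq> j" by auto
      then show "\<eta> p * M (\<lambda>i. \<xi> (as ! i) p) = 0" by (simp add: zero)
    qed
  qed (use j k in auto)
  also have "\<dots> = \<eta> j * M (\<lambda>i. \<xi> (as ! i) j) + (\<Sum>p = k..<N. \<eta> p * M (\<lambda>i. \<xi> (as ! i) p))"
    by (rule sum.insert) (use j in auto)
  finally have "\<eta> j * aug_det \<xi> g as [0..<k] +
      (\<Sum>p = k..<N. \<eta> p * aug_det \<xi> g as ([0..<j] @ p # [Suc j..<k])) = 0"
    unfolding M upt by (rule sym)
  then show ?thesis by (rule eq_neg_iff_add_eq_0[THEN iffD2])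
qed

section \<open>Spans and leading monomials\<close>

definition mon :: "monom \<Rightarrow> ('k::field) mpoly" where
  "mon u = Poly_Mapping.single u 1"

lemma mon_mult: "mon u * mon v = mon (u + v)"
  by (simp add: mon_def mult_single)

lemma mon_0 [simp]: "mon 0 = 1"
  by (simp add: mon_def)

lemma keys_mon [simp]: "Poly_Mapping.keys (mon u :: 'k::field mpoly) = {u}"
  by (simp add: mon_def)

lemma lookup_mon: "Poly_Mapping.lookup (mon u) v = (if u = v then 1 else 0)"
  by (simp add: mon_def lookup_single when_def)

lemma Var_eq_mon: "Var v = mon (Poly_Mapping.single v 1)"
  by (simp add: Var_def mon_def)

text \<open>
  Polynomials as a vector space over the field.  With constant coefficients each summand of a
  combination keeps its own leading monomial.
\<close>

definition scl :: "'k \<Rightarrow> ('k::field) mpoly \<Rightarrow> 'k mpoly" where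
  "scl c p = Poly_Mapping.single 0 c * p"

interpretation mp: vector_space "scl :: 'k::field \<Rightarrow> 'k mpoly \<Rightarrow> 'k mpoly"
  by unfold_locales
    (simp_all add: scl_def algebra_simps single_add mult_single flip: mult.assoc)

lemma scl_mult: "scl c p * q = scl c (p * q)"
  by (simp add: scl_def mult.assoc)

lemma mult_scl: "p * scl c q = scl c (p * q)"
  by (simp add: scl_def mult.left_commute)

lemma scl_mon: "scl c (mon u) = Poly_Mapping.single u c"
  by (simp add: scl_def mon_def mult_single)

lemma lookup_scl: "Poly_Mapping.lookup (scl c p) u = c * Poly_Mapping.lookup p u"
  unfolding scl_def mult_map_scale_conv_mult[symmetric] by (simp add: Poly_Mapping.map.rep_eq when_def)

lemma mpoly_eq_sum: "p = (\<Sum>\<kappa>\<in>Poly_Mapping.keys p. scl (Poly_Mapping.lookup p \<kappa>) (mon \<kappa>))"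
  by (rule poly_mapping_eqI)
    (simp add: lookup_sum scl_mon lookup_single when_def in_keys_iff)

text \<open>
  A product with any polynomial is a combination of products with monomials, so membership in a
  span is checked one monomial at a time.
\<close>

lemma mult_in_span:
  assumes "\<And>\<kappa>. \<kappa> \<in> Poly_Mapping.keys p \<Longrightarrow> mon \<kappa> * q \<in> mp.span S"
  shows "p * q \<in> mp.span S"
proof -
  have "p * q = (\<Sum>\<kappa>\<in>Poly_Mapping.keys p. scl (Poly_Mapping.lookup p \<kappa>) (mon \<kappa> * q))"
    by (subst mpoly_eq_sum[of p]) (simp add: sum_distrib_right scl_mult)
  then show ?thesis using assms by (simp add: mp.span_sum mp.span_scale)
qed

lemma mult_span:
  assumes "p \<in> mp.span S" "\<And>q. q \<in> S \<Longrightarrow> h * q \<in> mp.span T"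
  shows "h * p \<in> mp.span T"
  using assms(1)
proof (induction rule: mp.span_induct_alt)
  case (step c x y)
  then show ?case by (simp add: distrib_left mult_scl assms(2) mp.span_add mp.span_scale)
qed (simp add: mp.span_zero)

lemma lookup_mon_mult: "Poly_Mapping.lookup (mon u * p) (u + \<kappa>) = Poly_Mapping.lookup p \<kappa>"
proof -
  have "mon u * p = (\<Sum>\<nu>\<in>Poly_Mapping.keys p. scl (Poly_Mapping.lookup p \<nu>) (mon (u + \<nu>)))"
    by (subst mpoly_eq_sum[of p]) (simp add: sum_distrib_left mult_scl mon_mult)
  then show ?thesis
    by (simp add: lookup_sum scl_mon lookup_single when_def in_keys_iff)
qed

lemma keys_mon_mult: "Poly_Mapping.keys (mon u * p) = (+) u ` Poly_Mapping.keys p"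
proof
  show "Poly_Mapping.keys (mon u * p) \<subseteq> (+) u ` Poly_Mapping.keys p"
    using keys_mult[of "mon u" p] by auto
  show "(+) u ` Poly_Mapping.keys p \<subseteq> Poly_Mapping.keys (mon u * p)"
    by (auto simp: in_keys_iff lookup_mon_mult)
qed

definition is_lead :: "nat \<Rightarrow> ('k::field) mpoly \<Rightarrow> monom \<Rightarrow> bool" where
  "is_lead m p \<mu> \<longleftrightarrow> \<mu> \<in> Poly_Mapping.keys p \<and> (\<forall>\<nu>\<in>Poly_Mapping.keys p. \<nu> \<noteq> \<mu> \<longrightarrow> lex_less m \<nu> \<mu>)"

lemma lead_mon_eq: "is_lead m p \<mu> \<Longrightarrow> lead_mon m p = \<mu>"
  unfolding lead_mon_def is_lead_def
  by (rule the_equality) (auto dest: lex_less_trans simp: lex_less_irrefl, metis lex_less_irrefl lex_less_trans)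

lemma is_lead_mon_mult: "is_lead m p \<mu> \<Longrightarrow> is_lead m (mon u * p) (u + \<mu>)"
  by (auto simp: is_lead_def keys_mon_mult lex_less_add)

lemma finite_monoms_max:
  assumes "finite S" "S \<noteq> {}"
  shows "\<exists>\<mu>\<in>S. \<forall>\<nu>\<in>S. \<nu> \<noteq> \<mu> \<longrightarrow> lex_less m \<nu> \<mu>"
  using assms
proof (induction S rule: finite_ne_induct)
  case (insert \<nu> F)
  then obtain \<mu> where \<mu>: "\<mu> \<in> F" "\<forall>\<nu>\<in>F. \<nu> \<noteq> \<mu> \<longrightarrow> lex_less m \<nu> \<mu>" by blast
  then have "\<nu> \<noteq> \<mu>" using insert by blast
  then consider "lex_less m \<nu> \<mu>" | "lex_less m \<mu> \<nu>" using lex_less_total by blast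
  then show ?case
  proof cases
    case 2 then show ?thesis using \<mu> by (intro bexI[of _ \<nu>]) (auto dest: lex_less_trans)
  qed (use \<mu> in blast)
qed auto

text \<open>
  In a combination of polynomials with different leading monomials the largest one cannot cancel.
\<close>

lemma span_lead:
  assumes lead: "\<And>p. p \<in> S \<Longrightarrow> is_lead m p (L p)"
    and inj: "inj_on L S" and f: "f \<in> mp.span S" "f \<noteq> 0"
  shows "\<exists>p\<in>S. is_lead m f (L p)"
proof -
  obtain T c where T: "finite T" "T \<subseteq> S" and "f = (\<Sum>p\<in>T. scl (c p) p)"
    using f(1) by (auto simp: mp.span_explicit)
  define T' where "T' = {p \<in> T. c p \<noteq> 0}"
  have f_eq: "f = (\<Sum>p\<in>T'. scl (c p) p)"
    unfolding \<open>f = _\<close> by (rule sum.mono_neutral_right) (use T in \<open>auto simp: T'_def\<close>)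
  then have "T' \<noteq> {}" using f(2) by auto
  then obtain p where p: "p \<in> T'" "\<And>q. q \<in> T' \<Longrightarrow> L q \<noteq> L p \<Longrightarrow> lex_less m (L q) (L p)"
    using finite_monoms_max[of "L ` T'" m] T by (auto simp: T'_def)
  have L_less: "lex_less m (L q) (L p)" if "q \<in> T'" "q \<noteq> p" for q
    using p that inj T by (metis (mono_tags, lifting) T'_def inj_onD mem_Collect_eq subsetD)
  have key_le: "\<nu> = L p \<or> lex_less m \<nu> (L p)" if "q \<in> T'" "\<nu> \<in> Poly_Mapping.keys q" for q \<nu>
  proof -
    have "is_lead m q (L q)" using that T lead by (auto simp: T'_def)
    then show ?thesis using that L_less p(1) unfolding is_lead_def by (metis lex_less_trans)
  qed
  have other: "Poly_Mapping.lookup q (L p) = 0" if "q \<in> T'" "q \<noteq> p" for q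
  proof (rule ccontr)
    assume "Poly_Mapping.lookup q (L p) \<noteq> 0"
    then have "L p \<in> Poly_Mapping.keys q" by (simp add: in_keys_iff)
    moreover have "is_lead m q (L q)" using that T lead by (auto simp: T'_def)
    ultimately have "L p = L q \<or> lex_less m (L p) (L q)" unfolding is_lead_def by metis
    then show False using L_less[OF that] lex_less_irrefl lex_less_trans by metis
  qed
  have "Poly_Mapping.lookup f (L p) = (\<Sum>q\<in>T'. c q * Poly_Mapping.lookup q (L p))"
    by (simp add: f_eq lookup_sum lookup_scl)
  also have "\<dots> = (\<Sum>q\<in>{p}. c q * Poly_Mapping.lookup q (L p))"
    by (rule sum.mono_neutral_right) (use T p other in \<open>auto simp: T'_def\<close>)
  also have "\<dots> \<noteq> 0" using p(1) lead[of p] T by (auto simp: T'_def is_lead_def in_keys_iff)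
  finally have "L p \<in> Poly_Mapping.keys f" by (simp add: in_keys_iff)
  moreover have "\<nu> = L p \<or> lex_less m \<nu> (L p)" if "\<nu> \<in> Poly_Mapping.keys f" for \<nu>
  proof -
    have "(\<Sum>q\<in>T'. c q * Poly_Mapping.lookup q \<nu>) \<noteq> 0"
      using that by (simp add: f_eq in_keys_iff lookup_sum lookup_scl)
    then obtain q where "q \<in> T'" "c q * Poly_Mapping.lookup q \<nu> \<noteq> 0" by (meson sum.neutral)
    then show ?thesis using key_le by (auto simp: in_keys_iff)
  qed
  ultimately show ?thesis using p(1) T unfolding is_lead_def T'_def by blast
qed

section \<open>The monomials of the minors\<close>

text \<open>
  A term of the Leibniz expansion of a minor of \<open>[X]\<^sub>s\<close>: row \<open>as ! l\<close> contributes its entry in column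
  \<open>ts ! l\<close>.  The column list \<open>ts\<close> may contain repetitions.
\<close>

definition xmon :: "nat \<Rightarrow> nat \<Rightarrow> nat list \<Rightarrow> nat list \<Rightarrow> monom" where
  "xmon m s as ts = sum_list (map2 (\<lambda>i p. Poly_Mapping.single (XV i (front m s p)) 1) as ts)"

definition ymon :: "nat \<Rightarrow> nat \<Rightarrow> nat \<Rightarrow> monom" where
  "ymon m s p = Poly_Mapping.single (YV (front m s p) s) 1"

lemma xmon_Cons [simp]:
  "xmon m s (a # as) (t # ts) = Poly_Mapping.single (XV a (front m s t)) 1 + xmon m s as ts"
  by (simp add: xmon_def)

lemma xmon_Nil [simp]: "xmon m s [] ts = 0"
  by (simp add: xmon_def)

lemma lookup_ymon: "Poly_Mapping.lookup (ymon m s p) v = (if v = YV (front m s p) s then 1 else 0)"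
  by (auto simp: ymon_def lookup_single when_def)

lemma lookup_xmon_Y [simp]: "length as = length ts \<Longrightarrow> Poly_Mapping.lookup (xmon m s as ts) (YV k l) = 0"
  by (induction as ts rule: list_induct2) (simp_all add: lookup_add lookup_single when_def)

lemma lookup_xmon_notin:
  "length as = length ts \<Longrightarrow> i \<notin> set as \<Longrightarrow> Poly_Mapping.lookup (xmon m s as ts) (XV i j) = 0"
  by (induction as ts rule: list_induct2) (simp_all add: lookup_add lookup_single when_def)

lemma lookup_xmon_nth:
  "length as = length ts \<Longrightarrow> distinct as \<Longrightarrow> l < length as \<Longrightarrow>
   Poly_Mapping.lookup (xmon m s as ts) (XV (as ! l) j) = (if j = front m s (ts ! l) then 1 else 0)"
proof (induction as ts arbitrary: l rule: list_induct2)
  case (Cons a as t ts)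
  show ?case
  proof (cases l)
    case 0 then show ?thesis using Cons by (simp add: lookup_add lookup_single lookup_xmon_notin when_def)
  next
    case (Suc l')
    then have "as ! l' \<noteq> a" using Cons.prems nth_mem by fastforce
    then show ?thesis using Suc Cons by (simp add: lookup_add lookup_single when_def)
  qed
qed simp

lemma lookup_xmonD:
  assumes "length as = length ts" "distinct as" "Poly_Mapping.lookup (xmon m s as ts) v \<noteq> 0"
  obtains l where "l < length as" "v = XV (as ! l) (front m s (ts ! l))"
proof (cases v)
  case (XV i j)
  then have "i \<in> set as" using assms lookup_xmon_notin by metis
  then obtain l where "l < length as" "as ! l = i" by (auto simp: in_set_conv_nth)
  then show ?thesis using that[of l] XV assms lookup_xmon_nth[of as ts l m s j] by (auto split: if_splits)
qed (use assms in simp)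

lemma xmon_append:
  "length as = length ts \<Longrightarrow> xmon m s (as @ bs) (ts @ us) = xmon m s as ts + xmon m s bs us"
  by (simp add: xmon_def)

text \<open>
  On monomials this is one step of a Laplace expansion: the row \<open>as ! l\<close> is matched with the
  column \<open>c\<close>, the other rows with the remaining columns.
\<close>

lemma xmon_insert_at:
  assumes "length as = Suc (length ts)" "l < length as"
  shows "xmon m s as (insert_at l c ts) =
    Poly_Mapping.single (XV (as ! l) (front m s c)) 1 + xmon m s (delete_at l as) ts"
proof -
  have "xmon m s as (insert_at l c ts) =
    xmon m s (take l as @ as ! l # drop (Suc l) as) (take l ts @ c # drop l ts)"
    using assms by (simp add: insert_at_def id_take_nth_drop[symmetric])
  also have "\<dots> = xmon m s (take l as) (take l ts) +
      (Poly_Mapping.single (XV (as ! l) (front m s c)) 1 + xmon m s (drop (Suc l) as) (drop l ts))"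
    using assms by (subst xmon_append) auto
  also have "xmon m s (take l as) (take l ts) + xmon m s (drop (Suc l) as) (drop l ts) =
      xmon m s (delete_at l as) (take l ts @ drop l ts)"
    unfolding delete_at_def using assms by (subst xmon_append) auto
  then have "xmon m s (take l as) (take l ts) +
      (Poly_Mapping.single (XV (as ! l) (front m s c)) 1 + xmon m s (drop (Suc l) as) (drop l ts)) =
      Poly_Mapping.single (XV (as ! l) (front m s c)) 1 + xmon m s (delete_at l as) ts"
    unfolding add.left_commute[of "xmon m s (take l as) (take l ts)"] by simp
  finally show ?thesis .
qed

text \<open>
  The order reads the rows from top to bottom; inside the block \<open>s\<close> an earlier column is larger.
\<close>

lemma lex_less_xmon:
  assumes as: "sorted_wrt (<) as" and len: "length ts = length as" "length ts' = length as"
    and i: "i < length as" "\<And>l. l < i \<Longrightarrow> ts ! l = ts' ! l" "ts ! i < ts' ! i" "ts' ! i < m"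
  shows "lex_less m (xmon m s as ts') (xmon m s as ts)"
proof -
  have dist: "distinct as" using as by (simp add: strict_sorted_iff)
  define v where "v = XV (as ! i) (front m s (ts ! i))"
  have "Poly_Mapping.lookup (xmon m s as ts) v = 1" "Poly_Mapping.lookup (xmon m s as ts') v = 0"
    using i len dist by (simp_all add: v_def lookup_xmon_nth)
  moreover have "Poly_Mapping.lookup (xmon m s as ts') w = Poly_Mapping.lookup (xmon m s as ts) w"
    if w: "var_gt m w v" for w
  proof (cases w)
    case (XV r c)
    show ?thesis
    proof (cases "r \<in> set as")
      case True
      then obtain l where l: "l < length as" "r = as ! l" by (auto simp: in_set_conv_nth)
      have "r < as ! i \<or> r = as ! i \<and> c < front m s (ts ! i)"
        using w by (simp add: XV v_def var_gt_X_iff)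
      then show ?thesis
      proof
        assume "r < as ! i"
        then have "l < i" using l as i by (metis linorder_neqE_nat order_less_asym sorted_wrt_nth_less)
        then show ?thesis using l len dist i by (simp add: XV lookup_xmon_nth)
      next
        assume r: "r = as ! i \<and> c < front m s (ts ! i)"
        then have "l = i" using l i dist by (simp add: nth_eq_iff_index_eq)
        then show ?thesis using r l len dist i by (simp add: XV lookup_xmon_nth)
      qed
    qed (use len in \<open>simp add: XV lookup_xmon_notin\<close>)
  qed (use len in simp)
  ultimately show ?thesis unfolding lex_less_def by (intro exI[of _ v]) simp
qed

text \<open>
  The first column list entry that differs from the diagonal is larger than the diagonal one,
  since the smaller columns are already used up.  Hence the diagonal term of a minor leads.
\<close>

lemma lex_less_xmon_perm:
  assumes as: "sorted_wrt (<) as" and k: "length as \<le> m"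
    and ts: "mset ts = mset [0..<length as]" "ts \<noteq> [0..<length as]"
  shows "lex_less m (xmon m s as ts) (xmon m s as [0..<length as])"
proof -
  have len: "length ts = length as" using mset_eq_length[OF ts(1)] by simp
  have dist: "distinct ts" and set: "set ts = {..<length as}"
    using mset_eq_imp_distinct_iff[OF ts(1)] mset_eq_setD[OF ts(1)] by (auto simp: atLeast0LessThan)
  have "\<exists>i. i < length as \<and> ts ! i \<noteq> i" using ts(2) len by (metis add_0 diff_zero length_upt nth_equalityI nth_upt)
  define i where "i = (LEAST i. i < length as \<and> ts ! i \<noteq> i)"
  have i: "i < length as" "ts ! i \<noteq> i"
    using LeastI_ex[OF \<open>\<exists>i. i < length as \<and> ts ! i \<noteq> i\<close>] by (simp_all add: i_def)
  have before: "ts ! l = l" if "l < i" for l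
    using not_less_Least[of l "\<lambda>i. i < length as \<and> ts ! i \<noteq> i"] that i by (auto simp: i_def)
  have "\<not> ts ! i < i" using before dist i len by (metis nth_eq_iff_index_eq order.strict_trans)
  then have "i < ts ! i" using i by simp
  moreover have "ts ! i < length as" using set i len nth_mem by (metis lessThan_iff)
  ultimately show ?thesis
    using i before len k as by (intro lex_less_xmon[where i = i]) auto
qed

text \<open>
  Every \<open>y\<close>-variable is larger than every \<open>x\<close>-variable, so the entries of \<open>[Y]\<^sub>s\<close> decide before
  the \<open>x\<close>-parts are compared.
\<close>

lemma lex_less_ymon:
  assumes q: "q < p" and \<mu>: "\<And>k l. Poly_Mapping.lookup \<mu> (YV k l) = 0" and \<nu>: "\<And>k l. Poly_Mapping.lookup \<nu> (YV k l) = 0"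
  shows "lex_less m (\<mu> + ymon m s p) (\<nu> + ymon m s q)"
  unfolding lex_less_def
proof (intro exI[of _ "YV (front m s q) s"] conjI allI impI)
  show "Poly_Mapping.lookup (\<mu> + ymon m s p) (YV (front m s q) s)
      < Poly_Mapping.lookup (\<nu> + ymon m s q) (YV (front m s q) s)"
    using q by (simp add: lookup_add lookup_ymon \<mu> \<nu>)
next
  fix w assume w: "var_gt m w (YV (front m s q) s)"
  then have "w \<noteq> YV (front m s p) s" "w \<noteq> YV (front m s q) s"
    using q by (auto simp: var_gt_Y_iff)
  moreover obtain k l where "w = YV k l" using w by (cases w) (auto simp: not_var_gt_X_Y)
  ultimately show "Poly_Mapping.lookup (\<mu> + ymon m s p) w = Poly_Mapping.lookup (\<nu> + ymon m s q) w"
    by (simp add: lookup_add lookup_ymon \<mu> \<nu>)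
qed

section \<open>The leading monomial of a generator\<close>

definition row_list :: "nat \<Rightarrow> nat list \<Rightarrow> bool" where
  "row_list m as \<longleftrightarrow> as \<noteq> [] \<and> sorted_wrt (<) as \<and> set as \<subseteq> {..<m}"

lemma row_list_length: "row_list m as \<Longrightarrow> length as \<le> m"
  by (metis card_lessThan card_mono distinct_card finite_lessThan row_list_def strict_sorted_iff)

lemma G_set_eq: "G_set m n s = f_poly m n s ` {as. row_list m as}"
  unfolding G_set_def using row_list_length
  by (auto simp: row_list_def Suc_le_eq)

text \<open>
  The product of the diagonal of the minor in the first term of \<open>f_poly m n s as\<close> and of the
  entry of \<open>[Y]\<^sub>s\<close> that goes with it; \<open>is_lead_f_poly\<close> shows that it is the leading monomial.
\<close>

definition lead :: "nat \<Rightarrow> nat \<Rightarrow> nat list \<Rightarrow> monom" where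
  "lead m s as = xmon m s as [0..<length as] + ymon m s (length as - 1)"

lemma prod_Var_eq_xmon:
  assumes "length as = length ts"
  shows "(\<Prod>i = 0..<length as. Var (XV (as ! i) (front m s (ts ! i)))) = (mon (xmon m s as ts) :: 'k::field mpoly)"
  using assms
proof (induction as ts rule: list_induct2)
  case (Cons a as t ts)
  then show ?case
    by (simp add: prod.atLeast0_lessThan_Suc_shift Var_eq_mon mon_mult del: prod.op_ivl_Suc)
qed simp

lemma X_at_entry:
  "s < n \<Longrightarrow> i < m \<Longrightarrow> p < m * n \<Longrightarrow> X_at m n s $$ (i, p) = Var (XV i (front m s p))"
  by (simp add: X_at_def mat_X_def front_less)

lemma Y_at_entry: "s < n \<Longrightarrow> p < m * n \<Longrightarrow> Y_at m n s $$ (p, 0) = Var (YV (front m s p) s)"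
  by (simp add: Y_at_def mat_Y_def front_less)

lemma minor_eq_sum:
  assumes s: "s < n" and as: "set as \<subseteq> {..<m}" and cs: "set cs \<subseteq> {..<m * n}" and len: "length cs = length as"
  shows "minor (X_at m n s) as cs =
    (\<Sum>\<pi> | \<pi> permutes {0..<length as}. signof \<pi> * (mon (xmon m s as (permute_list \<pi> cs)) :: 'k::field mpoly))"
proof -
  let ?k = "length as"
  have entry: "X_at m n s $$ (as ! i, cs ! j) = (Var (XV (as ! i) (front m s (cs ! j))) :: 'k mpoly)"
    if "i < ?k" "j < ?k" for i j
    using that as cs len s by (intro X_at_entry) (auto simp: subset_iff)
  define M where "M = mat ?k ?k (\<lambda>(i, j). X_at m n s $$ (as ! i, cs ! j) :: 'k mpoly)"
  have M: "M \<in> carrier_mat ?k ?k" by (simp add: M_def)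
  have "det M = (\<Sum>\<pi> | \<pi> permutes {0..<?k}. signof \<pi> * (\<Prod>i = 0..<?k. M $$ (i, \<pi> i)))"
    by (rule det_def'[OF M])
  also have "\<dots> = (\<Sum>\<pi> | \<pi> permutes {0..<?k}. signof \<pi> * mon (xmon m s as (permute_list \<pi> cs)))"
  proof (rule sum.cong, rule refl)
    fix \<pi> assume "\<pi> \<in> {\<pi>. \<pi> permutes {0..<?k}}"
    then have \<pi>: "\<pi> i < ?k" if "i < ?k" for i
      using that permutes_in_image[of \<pi> "{0..<?k}" i] by simp
    have "(\<Prod>i = 0..<?k. M $$ (i, \<pi> i)) =
        (\<Prod>i = 0..<?k. Var (XV (as ! i) (front m s (permute_list \<pi> cs ! i))))"
      by (rule prod.cong) (simp_all add: M_def \<pi> entry permute_list_def len)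
    also have "\<dots> = mon (xmon m s as (permute_list \<pi> cs))"
      by (rule prod_Var_eq_xmon) (simp add: len)
    finally show "signof \<pi> * (\<Prod>i = 0..<?k. M $$ (i, \<pi> i)) = signof \<pi> * mon (xmon m s as (permute_list \<pi> cs))"
      by simp
  qed
  finally show ?thesis by (simp add: minor_def M_def len)
qed

lemma keys_minor:
  assumes "s < n" "set as \<subseteq> {..<m}" "set cs \<subseteq> {..<m * n}" "length cs = length as"
    and \<kappa>: "\<kappa> \<in> Poly_Mapping.keys (minor (X_at m n s) as cs :: 'k::field mpoly)"
  obtains ts where "mset ts = mset cs" "\<kappa> = xmon m s as ts"
proof -
  obtain \<pi> where \<pi>: "\<pi> permutes {0..<length as}"
    and "\<kappa> \<in> Poly_Mapping.keys (signof \<pi> * (mon (xmon m s as (permute_list \<pi> cs)) :: 'k mpoly))"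
    using subsetD[OF keys_sum \<kappa>[unfolded minor_eq_sum[OF assms(1-4)]]] by blast
  then have "\<kappa> = xmon m s as (permute_list \<pi> cs)" by (auto simp: sign_def split: if_splits)
  moreover have "mset (permute_list \<pi> cs) = mset cs"
    using \<pi> assms(4) by (intro mset_permute_list) (simp add: atLeast0LessThan)
  ultimately show ?thesis using that by blast
qed

text \<open>
  Only the identity permutation yields the diagonal term, and its sign is 1.
\<close>

lemma lookup_minor_diagonal:
  assumes s: "s < n" and as: "row_list m as"
  shows "Poly_Mapping.lookup (minor (X_at m n s) as [0..<length as] :: 'k::field mpoly)
           (xmon m s as [0..<length as]) = 1"
proof -
  let ?k = "length as"
  have k: "?k \<le> m" by (rule row_list_length[OF as])
  also have "m \<le> m * n" using s by simp
  finally have cs: "set [0..<?k] \<subseteq> {..<m * n}" by auto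
  have "Poly_Mapping.lookup (signof \<pi> * (mon (xmon m s as (permute_list \<pi> [0..<?k])) :: 'k mpoly)) (xmon m s as [0..<?k])
      = (if \<pi> = id then 1 else 0)" if \<pi>: "\<pi> permutes {0..<?k}" for \<pi>
  proof (cases "\<pi> = id")
    case False
    then obtain i where i: "\<pi> i \<noteq> i" by (auto simp: fun_eq_iff)
    then have "i < ?k" using \<pi> by (auto simp: permutes_def)
    then have "permute_list \<pi> [0..<?k] ! i \<noteq> [0..<?k] ! i"
      using i \<pi> permutes_in_image[of \<pi> "{0..<?k}" i] by (simp add: permute_list_def)
    then have "permute_list \<pi> [0..<?k] \<noteq> [0..<?k]" by metis
    moreover have "mset (permute_list \<pi> [0..<?k]) = mset [0..<?k]"
      using \<pi> by (intro mset_permute_list) (simp add: atLeast0LessThan)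
    ultimately have "lex_less m (xmon m s as (permute_list \<pi> [0..<?k])) (xmon m s as [0..<?k])"
      using as k by (intro lex_less_xmon_perm) (auto simp: row_list_def)
    then have "xmon m s as (permute_list \<pi> [0..<?k]) \<noteq> xmon m s as [0..<?k]"
      by (auto simp: lex_less_irrefl)
    then show ?thesis using False by (simp add: sign_def lookup_mon)
  qed (simp add: lookup_mon)
  then show ?thesis
    using as cs s
    by (subst minor_eq_sum) (auto simp: row_list_def lookup_sum finite_permutations permutes_id)
qed

lemma f_poly_eq:
  assumes "s < n"
  shows "f_poly m n s as = (\<Sum>p = length as - 1..<m * n.
    mon (ymon m s p) * minor (X_at m n s) as ([0..<length as - 1] @ [p]))"
  unfolding f_poly_def
  by (rule sum.cong) (simp_all add: Y_at_entry[OF assms] Var_eq_mon ymon_def mult.commute)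

lemma keys_f_poly:
  assumes s: "s < n" and as: "row_list m as"
    and \<kappa>: "\<kappa> \<in> Poly_Mapping.keys (f_poly m n s as :: 'k::field mpoly)"
  obtains ts p where "length as - 1 \<le> p" "p < m * n" "mset ts = mset ([0..<length as - 1] @ [p])"
    "\<kappa> = ymon m s p + xmon m s as ts"
proof -
  obtain p where p: "length as - 1 \<le> p" "p < m * n"
    and "\<kappa> \<in> Poly_Mapping.keys (mon (ymon m s p) * (minor (X_at m n s) as ([0..<length as - 1] @ [p]) :: 'k mpoly))"
    using subsetD[OF keys_sum \<kappa>[unfolded f_poly_eq[OF s]]] by auto
  then obtain \<kappa>' where "\<kappa> = ymon m s p + \<kappa>'"
    and \<kappa>': "\<kappa>' \<in> Poly_Mapping.keys (minor (X_at m n s) as ([0..<length as - 1] @ [p]) :: 'k mpoly)"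
    by (auto simp: keys_mon_mult)
  have "length as \<noteq> 0" "set as \<subseteq> {..<m}" using as by (auto simp: row_list_def)
  then have "set ([0..<length as - 1] @ [p]) \<subseteq> {..<m * n}" "length ([0..<length as - 1] @ [p]) = length as"
    using p by auto
  then obtain ts where "mset ts = mset ([0..<length as - 1] @ [p])" "\<kappa>' = xmon m s as ts"
    using keys_minor[OF s \<open>set as \<subseteq> {..<m}\<close> _ _ \<kappa>'] by blast
  then show ?thesis using that p \<open>\<kappa> = _\<close> by blast
qed

text \<open>
  A term with a later entry of \<open>[Y]\<^sub>s\<close> is smaller because of that entry.  Among the terms with the
  first possible entry the diagonal one is the largest.
\<close>

lemma is_lead_f_poly:
  assumes s: "s < n" and as: "row_list m as"
  shows "is_lead m (f_poly m n s as :: 'k::field mpoly) (lead m s as)"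
    and "Poly_Mapping.lookup (f_poly m n s as :: 'k mpoly) (lead m s as) = 1"
proof -
  let ?k = "length as"
  let ?M = "\<lambda>p. minor (X_at m n s) as ([0..<?k - 1] @ [p]) :: 'k mpoly"
  have k: "0 < ?k" "?k \<le> m" "sorted_wrt (<) as" using as row_list_length by (auto simp: row_list_def)
  have "m * 1 \<le> m * n" using s by (intro mult_le_mono2) simp
  then have kn: "?k - 1 < m * n" using k by linarith
  have upt: "[0..<?k - 1] @ [?k - 1] = [0..<?k]" using k upt_Suc_append[of 0 "?k - 1"] by simp
  have other: "Poly_Mapping.lookup (mon (ymon m s p) * ?M p) (lead m s as) = 0" if p: "p \<noteq> ?k - 1" "p < m * n" for p
  proof (rule ccontr)
    assume "Poly_Mapping.lookup (mon (ymon m s p) * ?M p) (lead m s as) \<noteq> 0"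
    then obtain \<kappa> where \<kappa>: "\<kappa> \<in> Poly_Mapping.keys (?M p)" "lead m s as = ymon m s p + \<kappa>"
      by (auto simp: keys_mon_mult simp flip: in_keys_iff)
    obtain ts where ts: "mset ts = mset ([0..<?k - 1] @ [p])" "\<kappa> = xmon m s as ts"
      by (rule keys_minor[OF s _ _ _ \<kappa>(1)]) (use as k kn p in \<open>auto simp: row_list_def\<close>)
    have len: "length ts = ?k" using mset_eq_length[OF ts(1)] k by simp
    have "Poly_Mapping.lookup (lead m s as) (YV (front m s p) s) \<noteq> 0"
      by (simp add: \<kappa>(2) lookup_add lookup_ymon)
    then show False using p by (simp add: lead_def lookup_add lookup_ymon)
  qed
  have "Poly_Mapping.lookup (f_poly m n s as :: 'k mpoly) (lead m s as)
      = (\<Sum>p = ?k - 1..<m * n. Poly_Mapping.lookup (mon (ymon m s p) * ?M p) (lead m s as))"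
    by (simp add: f_poly_eq[OF s] lookup_sum)
  also have "\<dots> = (\<Sum>p\<in>{?k - 1}. Poly_Mapping.lookup (mon (ymon m s p) * ?M p) (lead m s as))"
    by (rule sum.mono_neutral_right) (use other kn in auto)
  also have "\<dots> = Poly_Mapping.lookup (mon (ymon m s (?k - 1)) * ?M (?k - 1)) (ymon m s (?k - 1) + xmon m s as [0..<?k])"
    by (simp add: lead_def add.commute)
  also have "\<dots> = Poly_Mapping.lookup (minor (X_at m n s) as [0..<?k] :: 'k mpoly) (xmon m s as [0..<?k])"
    unfolding lookup_mon_mult upt ..
  also have "\<dots> = 1" by (rule lookup_minor_diagonal[OF s as])
  finally show one: "Poly_Mapping.lookup (f_poly m n s as :: 'k mpoly) (lead m s as) = 1" .
  have "lex_less m \<kappa> (lead m s as)" if \<kappa>: "\<kappa> \<in> Poly_Mapping.keys (f_poly m n s as :: 'k mpoly)" "\<kappa> \<noteq> lead m s as" for \<kappa>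
  proof -
    obtain ts p where p: "?k - 1 \<le> p" "mset ts = mset ([0..<?k - 1] @ [p])" "\<kappa> = ymon m s p + xmon m s as ts"
      by (rule keys_f_poly[OF s as \<kappa>(1)])
    have len: "length as = length ts" using mset_eq_length[OF p(2)] k by simp
    show ?thesis
    proof (cases "p = ?k - 1")
      case True
      then have "mset ts = mset [0..<?k]" using p(2) unfolding True upt by simp
      moreover have "ts \<noteq> [0..<?k]" using \<kappa>(2) p(3) True by (auto simp: lead_def add.commute)
      ultimately have "lex_less m (xmon m s as ts) (xmon m s as [0..<?k])"
        using k by (intro lex_less_xmon_perm)
      then show ?thesis
        unfolding p(3) True lead_def add.commute[of "xmon m s as _"] lex_less_add .
    next
      case False
      then have "lex_less m (xmon m s as ts + ymon m s p) (xmon m s as [0..<?k] + ymon m s (?k - 1))"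
        using p(1) len by (intro lex_less_ymon) auto
      then show ?thesis by (simp only: p(3) lead_def add.commute)
    qed
  qed
  with one show "is_lead m (f_poly m n s as :: 'k mpoly) (lead m s as)"
    by (auto simp: is_lead_def in_keys_iff)
qed

section \<open>Monomials in the variables of the ring\<close>

lemma keys_add_monom: "Poly_Mapping.keys (u + v :: monom) = Poly_Mapping.keys u \<union> Poly_Mapping.keys v"
  by (auto simp: in_keys_iff lookup_add)

lemma xvar_in_vars: "i < m \<Longrightarrow> p < m * n \<Longrightarrow> s < n \<Longrightarrow> XV i (front m s p) \<in> vars_R m n"
  by (simp add: vars_R_def front_less)

lemma keys_ymon_vars: "s < n \<Longrightarrow> p < m * n \<Longrightarrow> Poly_Mapping.keys (ymon m s p) \<subseteq> vars_R m n"
  by (simp add: ymon_def vars_R_def front_less)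

lemma keys_xmon_vars:
  assumes "s < n" "length as = length ts" "set as \<subseteq> {..<m}" "set ts \<subseteq> {..<m * n}"
  shows "Poly_Mapping.keys (xmon m s as ts) \<subseteq> vars_R m n"
  using assms(2-4)
  by (induction as ts rule: list_induct2) (auto simp: keys_add_monom xvar_in_vars[OF _ _ assms(1)])

lemma keys_f_poly_vars:
  assumes s: "s < n" and as: "row_list m as"
    and \<kappa>: "\<kappa> \<in> Poly_Mapping.keys (f_poly m n s as :: 'k::field mpoly)"
  shows "Poly_Mapping.keys \<kappa> \<subseteq> vars_R m n"
proof -
  obtain ts p where p: "length as - 1 \<le> p" "p < m * n" and ts: "mset ts = mset ([0..<length as - 1] @ [p])"
    and \<kappa>: "\<kappa> = ymon m s p + xmon m s as ts"
    by (rule keys_f_poly[OF s as \<kappa>])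
  have "length as = length ts" using mset_eq_length[OF ts] as by (simp add: row_list_def)
  moreover have "set ts \<subseteq> {..<m * n}" using mset_eq_setD[OF ts] p by auto
  ultimately show ?thesis
    using keys_ymon_vars[OF s p(2)] keys_xmon_vars[OF s] as by (simp add: \<kappa> keys_add_monom row_list_def)
qed

section \<open>Three reductions\<close>

definition entry :: "nat \<Rightarrow> nat \<Rightarrow> nat \<Rightarrow> nat \<Rightarrow> ('k::field) mpoly" where
  "entry m n s i = (\<Sum>p<m * n. Var (XV i (front m s p)) * Var (YV (front m s p) s))"

text \<open>
  The generators are determinants whose last column consists of the generators of the ideal
  themselves.  Other columns than the first ones are admitted as well, since they arise when one
  column is replaced.
\<close>

definition f_aug :: "nat \<Rightarrow> nat \<Rightarrow> nat \<Rightarrow> nat list \<Rightarrow> nat list \<Rightarrow> ('k::field) mpoly" where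
  "f_aug m n s = aug_det (\<lambda>i p. Var (XV i (front m s p))) (entry m n s)"

lemma block_le: "s < n \<Longrightarrow> m \<le> m * (n::nat)"
  by simp

text \<open>
  In the sum over all columns of \<open>[X]\<^sub>s\<close> the terms left out in \<open>f_poly\<close> are determinants with a
  repeated column.
\<close>

lemma f_poly_eq_f_aug:
  assumes s: "s < n" and as: "row_list m as"
  shows "f_poly m n s as = (f_aug m n s as [0..<length as - 1] :: 'k::field mpoly)"
proof -
  define k where "k = length as - 1"
  have len: "length as = Suc k" and sub: "set as \<subseteq> {..<m}" using as by (auto simp: row_list_def k_def)
  have kn: "Suc k \<le> m * n" using row_list_length[OF as] block_le[OF s, of m] len by linarith
  have minor: "det (mat (Suc k) (Suc k) (\<lambda>(i, j). Var (XV (as ! i) (front m s (([0..<k] @ [p]) ! j)))))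
      = (minor (X_at m n s) as ([0..<k] @ [p]) :: 'k mpoly)" if p: "p < m * n" for p
  proof -
    have "set ([0..<k] @ [p]) \<subseteq> {..<m * n}" using p kn by auto
    then have "([0..<k] @ [p]) ! j < m * n" if "j < Suc k" for j
      using that nth_mem[of j "[0..<k] @ [p]"] by (auto simp del: nth_mem)
    moreover have "as ! i < m" if "i < Suc k" for i
      using that sub nth_mem[of i as] len by (auto simp del: nth_mem)
    ultimately show ?thesis
      unfolding minor_def
      by (intro arg_cong[of _ _ det] eq_matI) (simp_all add: len X_at_entry[OF s])
  qed
  have "f_aug m n s as [0..<k] =
    (\<Sum>p = k..<m * n. det (mat (Suc k) (Suc k) (\<lambda>(i, j). Var (XV (as ! i) (front m s (([0..<k] @ [p]) ! j)))))
      * Var (YV (front m s p) s) :: 'k mpoly)"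
    unfolding f_aug_def by (rule aug_det_eq_sum) (use len kn in \<open>simp_all add: entry_def\<close>)
  also have "\<dots> = f_poly m n s as"
    unfolding f_poly_def k_def[symmetric]
    by (rule sum.cong) (simp_all add: minor Y_at_entry[OF s])
  finally show ?thesis by (simp add: k_def)
qed

definition f_multiple :: "nat \<Rightarrow> nat \<Rightarrow> monom \<Rightarrow> nat \<Rightarrow> nat list \<Rightarrow> ('k::field) mpoly" where
  "f_multiple m n u s as = mon u * f_poly m n s as"

definition admissible :: "nat \<Rightarrow> nat \<Rightarrow> nat set \<Rightarrow> monom \<Rightarrow> nat \<Rightarrow> nat list \<Rightarrow> bool" where
  "admissible m n T u s as \<longleftrightarrow> Poly_Mapping.keys u \<subseteq> vars_R m n \<and> s \<in> T \<and> row_list m as"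

text \<open>
  The order in which multiples are eliminated.  The leading monomial counts first; the other
  components decide which of several multiples with the same leading monomial is kept.  The sum
  of the row indices drops when one row is replaced by an earlier one.
\<close>

definition lower :: "nat \<Rightarrow> monom \<Rightarrow> nat \<Rightarrow> nat list \<Rightarrow> monom \<Rightarrow> nat \<Rightarrow> nat list \<Rightarrow> bool" where
  "lower m u' s' as' u s as \<longleftrightarrow>
     lex_less m (u' + lead m s' as') (u + lead m s as) \<or>
     u' + lead m s' as' = u + lead m s as \<and>
       ((s', length as', sum_list as'), (s, length as, sum_list as)) \<in> less_than <*lex*> less_than <*lex*> less_than"

definition below :: "nat \<Rightarrow> nat \<Rightarrow> nat set \<Rightarrow> monom \<Rightarrow> nat \<Rightarrow> nat list \<Rightarrow> ('k::field) mpoly set" where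
  "below m n T u s as = {f_multiple m n u' s' as' | u' s' as'. admissible m n T u' s' as' \<and> lower m u' s' as' u s as}"

text \<open>
  The field does not occur in the other arguments, hence the type argument.
\<close>

definition reducible :: "'k::field itself \<Rightarrow> nat \<Rightarrow> nat \<Rightarrow> nat set \<Rightarrow> monom \<Rightarrow> nat \<Rightarrow> nat list \<Rightarrow> bool" where
  "reducible _ m n T u s as \<longleftrightarrow> (f_multiple m n u s as :: 'k mpoly) \<in> mp.span (below m n T u s as)"

lemma belowI:
  "admissible m n T u' s' as' \<Longrightarrow> lower m u' s' as' u s as \<Longrightarrow>
   p = f_multiple m n u' s' as' \<Longrightarrow> p \<in> mp.span (below m n T u s as)"
  by (rule mp.span_base) (auto simp: below_def)

lemma sign_mult_span: "p \<in> mp.span S \<Longrightarrow> (-1) ^ e * p \<in> mp.span S"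
  by (cases "even e") (simp_all add: mp.span_neg)

text \<open>
  Leading monomials of different columns have no variable in common.  If the cofactor of
  \<open>f = f_poly m n s as\<close> contains the leading monomial \<open>\<lambda>\<close> of \<open>g = f_poly m n s' bs\<close>, then
  \<open>\<lambda> f = f g - (g - \<lambda>) f\<close>.  In the first product only the leading term of \<open>f\<close> reaches the original
  leading monomial, as a multiple of \<open>g\<close>, which belongs to an earlier column; the second product
  stays strictly below.
\<close>

lemma reducible_coprime:
  assumes T: "T \<subseteq> {..<n}" and adm: "admissible m n T (u + lead m s' bs) s as"
    and s': "s' \<in> T" "s' < s" and bs: "row_list m bs"
  shows "reducible TYPE('k::field) m n T (u + lead m s' bs) s as"
proof -
  let ?B = "below m n T (u + lead m s' bs) s as :: 'k mpoly set"
  let ?f = "f_poly m n s as :: 'k mpoly" and ?g = "f_poly m n s' bs :: 'k mpoly"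
  have s: "s \<in> T" "s < n" "s' < n" and as: "row_list m as"
    and u: "Poly_Mapping.keys u \<subseteq> vars_R m n"
    using adm T s' by (auto simp: admissible_def keys_add_monom)
  note lf = is_lead_f_poly(1)[OF s(2) as, where 'k = 'k] and lg = is_lead_f_poly[OF s(3) bs, where 'k = 'k]
  define tail where "tail = ?g - mon (lead m s' bs)"
  have tail: "\<kappa> \<in> Poly_Mapping.keys ?g \<and> lex_less m \<kappa> (lead m s' bs)" if "\<kappa> \<in> Poly_Mapping.keys tail" for \<kappa>
  proof -
    have "\<kappa> \<noteq> lead m s' bs" using that lg(2) by (auto simp: tail_def in_keys_iff lookup_minus lookup_mon)
    moreover from this have "\<kappa> \<in> Poly_Mapping.keys ?g"
      using that by (auto simp: tail_def in_keys_iff lookup_minus lookup_mon)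
    ultimately show ?thesis using lg(1) by (auto simp: is_lead_def)
  qed
  have "?f * (mon u * ?g) \<in> mp.span ?B"
  proof (rule mult_in_span)
    fix \<kappa> assume \<kappa>: "\<kappa> \<in> Poly_Mapping.keys ?f"
    then have "\<kappa> = lead m s as \<or> lex_less m \<kappa> (lead m s as)" using lf by (auto simp: is_lead_def)
    then have "lower m (\<kappa> + u) s' bs (u + lead m s' bs) s as"
      using s' lex_less_add_right[of m \<kappa> "u + lead m s' bs" "lead m s as"]
      by (auto simp: lower_def ac_simps)
    moreover have "admissible m n T (\<kappa> + u) s' bs"
      using keys_f_poly_vars[OF s(2) as \<kappa>] u s' bs by (auto simp: admissible_def keys_add_monom)
    ultimately show "mon \<kappa> * (mon u * ?g) \<in> mp.span ?B"
      by (elim belowI[rotated]) (simp add: f_multiple_def mon_mult flip: mult.assoc)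
  qed
  moreover have "tail * (mon u * ?f) \<in> mp.span ?B"
  proof (rule mult_in_span)
    fix \<kappa> assume \<kappa>: "\<kappa> \<in> Poly_Mapping.keys tail"
    then have "lower m (\<kappa> + u) s as (u + lead m s' bs) s as"
      using tail lex_less_add_right[of m \<kappa> "u + lead m s as" "lead m s' bs"]
      by (auto simp: lower_def ac_simps)
    moreover have "admissible m n T (\<kappa> + u) s as"
      using keys_f_poly_vars[OF s(3) bs] tail[OF \<kappa>] u s as by (auto simp: admissible_def keys_add_monom)
    ultimately show "mon \<kappa> * (mon u * ?f) \<in> mp.span ?B"
      by (elim belowI[rotated]) (simp add: f_multiple_def mon_mult flip: mult.assoc)
  qed
  ultimately have "?f * (mon u * ?g) - tail * (mon u * ?f) \<in> mp.span ?B" by (rule mp.span_diff)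
  also have "?f * (mon u * ?g) - tail * (mon u * ?f) = f_multiple m n (u + lead m s' bs) s as"
    by (simp add: tail_def f_multiple_def algebra_simps flip: mon_mult)
  finally show ?thesis by (simp add: reducible_def)
qed

lemma row_list_delete_at: "row_list m as \<Longrightarrow> l < length as \<Longrightarrow> length as \<noteq> 1 \<Longrightarrow> row_list m (delete_at l as)"
  using set_delete_at[of l as] length_delete_at[of l as] sorted_delete_at[of as l]
  by (auto simp: row_list_def simp del: length_delete_at)

text \<open>
  If the cofactor contains the variable in row \<open>i\<close> and column \<open>j\<close> of \<open>[X]\<^sub>s\<close>, where \<open>i\<close> fits strictly
  between the rows \<open>as ! (j - 1)\<close> and \<open>as ! j\<close>, then insert \<open>i\<close> into the row list and append column
  \<open>j\<close> to the ordinary columns.  The resulting determinant is zero if column \<open>j\<close> was there before, and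
  a generator of larger size otherwise.  Its expansion along the new column contains the given
  multiple as the term for row \<open>i\<close>.  The next row yields the same leading monomial with \<open>as ! j\<close>
  replaced by \<open>i\<close>; all other rows yield smaller monomials.
\<close>

lemma reducible_row:
  assumes T: "T \<subseteq> {..<n}"
    and adm: "admissible m n T (u + Poly_Mapping.single (XV i (front m s j)) 1) s as"
    and j: "j < length as" "i < as ! j" "j > 0 \<Longrightarrow> as ! (j - 1) < i"
  shows "reducible TYPE('k::field) m n T (u + Poly_Mapping.single (XV i (front m s j)) 1) s as"
proof -
  define v where "v = u + Poly_Mapping.single (XV i (front m s j)) 1"
  let ?B = "below m n T v s as :: 'k mpoly set"
  have s: "s \<in> T" "s < n" and as: "row_list m as" and u: "Poly_Mapping.keys u \<subseteq> vars_R m n"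
    using adm T by (auto simp: admissible_def keys_add_monom)
  define k where "k = length as"
  define A where "A = insert_at j i as"
  have k: "0 < k" "j < k" "k \<le> m" using as j row_list_length by (auto simp: k_def row_list_def)
  then have kn: "j < m * n" using block_le[OF s(2), of m] by linarith
  have A_len: "length A = Suc k" by (simp add: A_def k_def)
  have A_del: "delete_at j A = as" using j by (simp add: A_def)
  have A_nth: "A ! j = i" "A ! Suc j = as ! j" using j by (simp_all add: A_def nth_insert_at)
  have "as ! j < m" using as j nth_mem[of j as] by (auto simp: row_list_def simp del: nth_mem)
  then have A: "row_list m A"
    using as j sorted_insert_at[of as j i] by (auto simp: row_list_def A_def) (auto simp: insert_at_def)
  have A_le: "A ! l < m" if "l < Suc k" for l
    using A that nth_mem[of l A] by (auto simp: row_list_def A_len simp del: nth_mem)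
  have v: "v + lead m s as = u + (xmon m s A (insert_at j j [0..<k]) + ymon m s (k - 1))"
    using k by (simp add: v_def lead_def xmon_insert_at A_len A_nth A_del k_def[symmetric] ac_simps)
  define F where "F l = Var (XV (A ! l) (front m s j)) * (f_poly m n s (delete_at l A) :: 'k mpoly)" for l
  define H where "H = (f_aug m n s A ([0..<k - 1] @ [j]) :: 'k mpoly)"
  have del: "row_list m (delete_at l A)" "length (delete_at l A) = k" if "l < Suc k" for l
    using row_list_delete_at[OF A] that A_len k by auto
  \<comment> \<open>\<open>F j\<close> is the multiple to be reduced, up to the common factor \<open>u\<close>.\<close>
  have H_sum: "H = (\<Sum>l<Suc k. (-1) ^ (l + (k - 1)) * F l)"
    unfolding H_def f_aug_def
    by (subst aug_det_expand)
      (use k A_len del in \<open>auto intro!: sum.cong simp: F_def f_poly_eq_f_aug[OF s(2)] f_aug_def\<close>)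
  have "mon u * H \<in> mp.span ?B"
  proof (cases "j = k - 1")
    case True
    then have "[0..<k - 1] @ [j] = [0..<length A - 1]"
      using k A_len upt_Suc_append[of 0 "k - 1"] by simp
    then have H: "H = f_poly m n s A" by (simp add: H_def f_poly_eq_f_aug[OF s(2) A])
    have "lex_less m (xmon m s A [0..<Suc k] + ymon m s k) (xmon m s A (insert_at j j [0..<k]) + ymon m s (k - 1))"
      using k A_len by (intro lex_less_ymon) simp_all
    then have "lower m u s A v s as"
      by (simp add: lower_def v lead_def[of m s A] A_len lex_less_add del: upt_Suc)
    then show ?thesis
      unfolding H by (rule belowI[rotated]) (use u s A in \<open>simp_all add: admissible_def f_multiple_def\<close>)
  next
    case False
    then have "H = 0"
      unfolding H_def f_aug_def using k A_len
      by (intro aug_det_repeat[where i = j and j = "k - 1"]) (auto simp: nth_append)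
    then show ?thesis by (simp add: mp.span_zero)
  qed
  moreover have "mon u * F l \<in> mp.span ?B" if l: "l < Suc k" "l \<noteq> j" for l
  proof -
    define v' where "v' = u + Poly_Mapping.single (XV (A ! l) (front m s j)) 1"
    have v': "v' + lead m s (delete_at l A) = u + (xmon m s A (insert_at l j [0..<k]) + ymon m s (k - 1))"
      using l by (simp add: v'_def lead_def xmon_insert_at A_len del(2) ac_simps)
    have "lower m v' s (delete_at l A) v s as"
    proof (cases "l = Suc j")
      case True
      \<comment> \<open>The leading monomials agree, and the sum of the rows decides.\<close>
      have "insert_at l j [0..<k] = insert_at j j [0..<k]"
        using True k by (intro nth_equalityI) (auto simp: nth_insert_at)
      moreover have "sum_list (delete_at l A) < sum_list as"
        using sum_list_delete_at[of l A] sum_list_delete_at[of j A] l A_nth j A_len True A_del k by simp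
      ultimately show ?thesis
        using del(2)[OF l(1)] unfolding lower_def v v' by (simp add: k_def)
    next
      case False
      have "lex_less m (xmon m s A (insert_at l j [0..<k])) (xmon m s A (insert_at j j [0..<k]))"
      proof (cases "l < j")
        case True
        then show ?thesis
          using A A_len k l by (intro lex_less_xmon[where i = l]) (auto simp: nth_insert_at row_list_def)
      next
        case nless: False
        then show ?thesis
          using A A_len k l False
          by (intro lex_less_xmon[where i = "Suc j"]) (auto simp: nth_insert_at row_list_def)
      qed
      then show ?thesis
        unfolding lower_def v v' lex_less_add by (simp add: lex_less_add_right)
    qed
    moreover have "admissible m n T v' s (delete_at l A)"
      using u s del(1)[OF l(1)] xvar_in_vars[OF A_le[OF l(1)] kn s(2)]
      by (auto simp: admissible_def v'_def keys_add_monom)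
    ultimately show ?thesis
      by (elim belowI[rotated]) (simp add: F_def f_multiple_def v'_def Var_eq_mon mon_mult flip: mult.assoc)
  qed
  then have "(\<Sum>l\<in>{..<Suc k} - {j}. (-1) ^ (l + (k - 1)) * (mon u * F l)) \<in> mp.span ?B"
    by (intro mp.span_sum sign_mult_span) auto
  ultimately have "mon u * H - (\<Sum>l\<in>{..<Suc k} - {j}. (-1) ^ (l + (k - 1)) * (mon u * F l)) \<in> mp.span ?B"
    by (rule mp.span_diff)
  also have "mon u * H - (\<Sum>l\<in>{..<Suc k} - {j}. (-1) ^ (l + (k - 1)) * (mon u * F l))
      = (-1) ^ (j + (k - 1)) * (mon u * F j)"
    unfolding H_sum using k
    by (subst sum.remove[of _ j]) (simp_all add: algebra_simps sum_distrib_left)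
  \<comment> \<open>The sign is removed by multiplying with it once more.\<close>
  finally have "(-1) ^ (j + (k - 1)) * ((-1) ^ (j + (k - 1)) * (mon u * F j)) \<in> mp.span ?B"
    by (rule sign_mult_span)
  then have "mon u * F j \<in> mp.span ?B"
    by (simp flip: mult.assoc power_add)
  also have "mon u * F j = f_multiple m n v s as"
    by (simp add: F_def A_nth A_del v_def f_multiple_def Var_eq_mon mon_mult flip: mult.assoc)
  finally show ?thesis by (simp add: reducible_def v_def)
qed

text \<open>
  Expanding along the columns \<open>ds\<close> one after the other leaves generators of size \<open>Suc j\<close>.  The
  span absorbs signs and multiplicities; the cofactor and the diagonal of the smaller minor
  together form a term of the large determinant, which bounds the leading monomial.
\<close>

lemma f_aug_expand:
  assumes s: "s < n"
  shows "row_list m as \<Longrightarrow> length as = Suc j + length ds \<Longrightarrow>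
    (f_aug m n s as ([0..<j] @ ds) :: 'k::field mpoly) \<in> mp.span
      {mon w * f_poly m n s bs | w bs. row_list m bs \<and> length bs = Suc j \<and>
        (\<exists>ts. mset ts = mset ([0..<Suc j] @ ds) \<and> w + xmon m s bs [0..<Suc j] = xmon m s as ts)}"
    (is "_ \<Longrightarrow> _ \<Longrightarrow> _ \<in> mp.span (?S as ds)")
proof (induction ds arbitrary: as rule: rev_induct)
  case Nil
  then have "f_aug m n s as ([0..<j] @ []) = mon 0 * (f_poly m n s as :: 'k mpoly)"
    by (simp add: f_poly_eq_f_aug[OF s])
  also have "\<dots> \<in> ?S as []"
    using Nil by (intro CollectI, intro exI[of _ "0 :: monom"], intro exI[of _ as])
      (auto simp del: upt_Suc intro: exI[of _ "[0..<Suc j]"])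
  finally show ?case by (rule mp.span_base)
next
  case (snoc c ds)
  have len: "length as = Suc (Suc (length ([0..<j] @ ds)))" using snoc.prems by simp
  have "f_aug m n s as (([0..<j] @ ds) @ [c]) \<in> mp.span (?S as (ds @ [c]))"
    unfolding f_aug_def aug_det_expand[OF len]
  proof (intro mp.span_sum sign_mult_span)
    fix l assume "l \<in> {..<length as}"
    then have l: "l < length as" by simp
    have del: "row_list m (delete_at l as)" "length (delete_at l as) = Suc j + length ds"
      using row_list_delete_at snoc.prems l by auto
    show "Var (XV (as ! l) (front m s c)) * aug_det (\<lambda>i p. Var (XV i (front m s p))) (entry m n s) (delete_at l as) ([0..<j] @ ds)
        \<in> mp.span (?S as (ds @ [c]))"
    proof (rule mult_span[OF snoc.IH[OF del, unfolded f_aug_def]])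
      fix q assume "q \<in> ?S (delete_at l as) ds"
      then obtain w bs ts where q: "q = mon w * f_poly m n s bs" "row_list m bs" "length bs = Suc j"
        and ts: "mset ts = mset ([0..<Suc j] @ ds)" "w + xmon m s bs [0..<Suc j] = xmon m s (delete_at l as) ts"
        by blast
      define w' where "w' = Poly_Mapping.single (XV (as ! l) (front m s c)) 1 + w"
      have "length as = Suc (length ts)" using mset_eq_length[OF ts(1)] len by simp
      then have "w' + xmon m s bs [0..<Suc j] = xmon m s as (insert_at l c ts)"
        using l ts(2) by (simp add: xmon_insert_at w'_def add.assoc del: upt_Suc)
      moreover have "mset (insert_at l c ts) = mset ([0..<Suc j] @ (ds @ [c]))" by (simp add: ts(1))
      moreover have "Var (XV (as ! l) (front m s c)) * q = mon w' * f_poly m n s bs"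
        by (simp add: q(1) w'_def Var_eq_mon mon_mult flip: mult.assoc)
      ultimately have "Var (XV (as ! l) (front m s c)) * q \<in> ?S as (ds @ [c])" using q by blast
      then show "Var (XV (as ! l) (front m s c)) * q \<in> mp.span (?S as (ds @ [c]))" by (rule mp.span_base)
    qed
  qed
  then show ?case by simp
qed

text \<open>
  If the cofactor contains an earlier entry of \<open>[Y]\<^sub>s\<close> than the leading monomial does, then
  \<open>mult_aug_det\<close> trades that entry for the entries from position \<open>k\<close> on, and \<open>f_aug_expand\<close> leads back to
  generators of smaller size.  The original leading monomial can only reappear with \<open>p = k\<close> and
  the diagonal term.
\<close>

lemma reducible_y:
  assumes T: "T \<subseteq> {..<n}" and adm: "admissible m n T (u + ymon m s j) s as" and j: "Suc j < length as"
  shows "reducible TYPE('k::field) m n T (u + ymon m s j) s as"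
proof -
  let ?B = "below m n T (u + ymon m s j) s as :: 'k mpoly set"
  define k where "k = length as - 1"
  have s: "s \<in> T" "s < n" and as: "row_list m as" and u: "Poly_Mapping.keys u \<subseteq> vars_R m n"
    using adm T by (auto simp: admissible_def keys_add_monom)
  have k: "length as = Suc k" "j < k" "k < m" using j row_list_length[OF as] by (simp_all add: k_def)
  then have kn: "k \<le> m * n" using block_le[OF s(2), of m] by linarith
  have "Var (YV (front m s j) s) * f_aug m n s as [0..<k] =
    - (\<Sum>p = k..<m * n. Var (YV (front m s p) s) * (f_aug m n s as ([0..<j] @ p # [Suc j..<k]) :: 'k mpoly))"
    unfolding f_aug_def
    by (rule mult_aug_det[OF _ k(1,2) kn, where \<eta> = "\<lambda>p. Var (YV (front m s p) s)"]) (simp add: entry_def)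
  then have "f_multiple m n (u + ymon m s j) s as =
    - (\<Sum>p = k..<m * n. mon (u + ymon m s p) * (f_aug m n s as ([0..<j] @ p # [Suc j..<k]) :: 'k mpoly))"
    unfolding f_multiple_def f_poly_eq_f_aug[OF s(2) as] k_def[symmetric] mon_mult[symmetric] mult.assoc
    by (simp add: ymon_def Var_eq_mon sum_distrib_left)
  also have "\<dots> \<in> mp.span ?B"
  proof (intro mp.span_neg mp.span_sum)
    fix p assume "p \<in> {k..<m * n}"
    then have p: "k \<le> p" "p < m * n" by auto
    have len: "length as = Suc j + length (p # [Suc j..<k])" using k by simp
    show "mon (u + ymon m s p) * f_aug m n s as ([0..<j] @ p # [Suc j..<k]) \<in> mp.span ?B"
    proof (rule mult_span[OF f_aug_expand[OF s(2) as len]])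
      fix q :: "'k mpoly"
      assume "q \<in> {mon w * f_poly m n s bs | w bs. row_list m bs \<and> length bs = Suc j \<and>
        (\<exists>ts. mset ts = mset ([0..<Suc j] @ p # [Suc j..<k]) \<and> w + xmon m s bs [0..<Suc j] = xmon m s as ts)}"
      then obtain w bs ts where q: "q = mon w * f_poly m n s bs" and bs: "row_list m bs" "length bs = Suc j"
        and ts: "mset ts = mset ([0..<Suc j] @ p # [Suc j..<k])" "w + xmon m s bs [0..<Suc j] = xmon m s as ts"
        by blast
      define u' where "u' = u + ymon m s p + w"
      have len_ts: "length as = length ts" using mset_eq_length[OF ts(1)] len by simp
      have lead_bs: "lead m s bs = xmon m s bs [0..<Suc j] + ymon m s j"
        unfolding lead_def bs(2) by simp
      have lead_as: "lead m s as = xmon m s as [0..<Suc k] + ymon m s k"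
        unfolding lead_def k(1) by simp
      have u': "u' + lead m s bs = (u + ymon m s j) + (xmon m s as ts + ymon m s p)"
        unfolding u'_def lead_bs ts(2)[symmetric] by (simp only: ac_simps)
      have "lower m u' s bs (u + ymon m s j) s as"
      proof (cases "p = k")
        case True
        have "[0..<Suc k] = [0..<Suc j] @ [Suc j..<k] @ [k]"
          using k upt_add_eq_append[of 0 "Suc j" "k - Suc j"] by simp
        then have "mset ts = mset [0..<length as]" by (simp add: ts(1) True k(1) del: upt_Suc)
        then have "ts = [0..<Suc k] \<or> lex_less m (xmon m s as ts) (xmon m s as [0..<Suc k])"
          using lex_less_xmon_perm[of as m ts s] as row_list_length[OF as] by (auto simp: row_list_def k(1))
        then show ?thesis
          unfolding lower_def u' lead_as True lex_less_add lex_less_add_right using k bs by auto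
      next
        case False
        then have "lex_less m (xmon m s as ts + ymon m s p) (xmon m s as [0..<Suc k] + ymon m s k)"
          using p len_ts k by (intro lex_less_ymon) (simp_all del: upt_Suc)
        then show ?thesis unfolding lower_def u' lead_as lex_less_add by blast
      qed
      moreover have "admissible m n T u' s bs"
      proof -
        have "set ts \<subseteq> {..<m * n}"
          using mset_eq_setD[OF ts(1)] p k kn by auto
        then have "Poly_Mapping.keys (xmon m s as ts) \<subseteq> vars_R m n"
          using as len_ts s by (intro keys_xmon_vars) (auto simp: row_list_def)
        then show ?thesis
          using u s bs(1) keys_ymon_vars[OF s(2) p(2)]
          unfolding admissible_def u'_def keys_add_monom ts(2)[symmetric] by blast
      qed
      ultimately show "mon (u + ymon m s p) * q \<in> mp.span ?B"
        by (elim belowI[rotated]) (simp add: q u'_def f_multiple_def mon_mult flip: mult.assoc)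
    qed
  qed
  finally show ?thesis by (simp add: reducible_def)
qed

section \<open>Irreducible multiples\<close>

lemma lookup_leadD:
  assumes as: "row_list m as" and v: "Poly_Mapping.lookup (lead m s as) v \<noteq> 0"
  shows "v = YV (front m s (length as - 1)) s \<or> (\<exists>l<length as. v = XV (as ! l) (m * s + l))"
proof (cases "v = YV (front m s (length as - 1)) s")
  case False
  then have "Poly_Mapping.lookup (xmon m s as [0..<length as]) v \<noteq> 0"
    using v by (simp add: lead_def lookup_add lookup_ymon)
  moreover have "distinct as" using as by (simp add: row_list_def strict_sorted_iff)
  ultimately obtain l where "l < length as" "v = XV (as ! l) (front m s ([0..<length as] ! l))"
    by (elim lookup_xmonD[rotated 2]) auto
  then show ?thesis using row_list_length[OF as] by auto
qed simp

lemma lookup_lead_Y: "Poly_Mapping.lookup (lead m s as) (YV k l) = (if YV k l = YV (front m s (length as - 1)) s then 1 else 0)"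
  by (simp add: lead_def lookup_add lookup_ymon)

lemma lookup_lead_X:
  assumes "row_list m as" "l < length as"
  shows "Poly_Mapping.lookup (lead m s as) (XV (as ! l) c) = (if c = m * s + l then 1 else 0)"
proof -
  have "distinct as" using assms by (simp add: row_list_def strict_sorted_iff)
  then show ?thesis
    using assms row_list_length[of m as] by (simp add: lead_def lookup_add lookup_ymon lookup_xmon_nth)
qed

lemma block_eq:
  assumes "m * s + p = m * s' + (q::nat)" "p < m" "q < m"
  shows "s = s'" "p = q"
proof -
  have "(m * s + p) div m = s" "(m * s' + q) div m = s'" using assms(2,3) by auto
  then show "s = s'" using assms(1) by metis
  then show "p = q" using assms by simp
qed

lemma lead_coprime:
  assumes "row_list m as" "row_list m bs" "s \<noteq> s'" "Poly_Mapping.lookup (lead m s as) v \<noteq> 0"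
  shows "Poly_Mapping.lookup (lead m s' bs) v = 0"
proof (rule ccontr)
  assume "Poly_Mapping.lookup (lead m s' bs) v \<noteq> 0"
  then show False
    using lookup_leadD[OF assms(2)] lookup_leadD[OF assms(1,4)] assms(3)
      row_list_length[OF assms(1)] row_list_length[OF assms(2)] block_eq(1)[of m s _ s']
    by fastforce
qed

lemma monom_diff_add:
  assumes "\<And>v. Poly_Mapping.lookup d v \<le> Poly_Mapping.lookup (u :: monom) v"
  shows "u = (u - d) + d"
  using assms by (intro poly_mapping_eqI) (simp add: lookup_add lookup_minus)

lemma monom_single_diff_add:
  assumes "0 < Poly_Mapping.lookup (u :: monom) v"
  shows "u = (u - Poly_Mapping.single v 1) + Poly_Mapping.single v 1"
  using assms by (intro monom_diff_add) (auto simp: lookup_single when_def)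

text \<open>
  Each way in which the first multiple can come after the second one puts a variable, or a whole
  leading monomial, of the second generator into the cofactor of the first one, and so calls for
  one of the three reductions.
\<close>

lemma reducible_if_same_lead:
  assumes T: "T \<subseteq> {..<n}" and adm: "admissible m n T u s as" "admissible m n T u' s' bs"
    and same: "u + lead m s as = u' + lead m s' bs"
    and less: "s' < s \<or> s' = s \<and> (length bs < length as \<or>
      length bs = length as \<and> (\<exists>j<length as. bs ! j < as ! j \<and> (\<forall>l<j. bs ! l = as ! l)))"
  shows "reducible TYPE('k::field) m n T u s as"
proof -
  have as: "row_list m as" and bs: "row_list m bs" and s': "s' \<in> T" using adm by (auto simp: admissible_def)
  have sum: "Poly_Mapping.lookup u v + Poly_Mapping.lookup (lead m s as) v =
      Poly_Mapping.lookup u' v + Poly_Mapping.lookup (lead m s' bs) v" for v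
    using same by (metis lookup_add)
  consider (column) "s' < s" | (length) "s' = s" "length bs < length as"
    | (row) j where "s' = s" "length bs = length as" "j < length as" "bs ! j < as ! j" "\<And>l. l < j \<Longrightarrow> bs ! l = as ! l"
    using less by blast
  then show ?thesis
  proof cases
    case column
    have "u = (u - lead m s' bs) + lead m s' bs"
    proof (rule monom_diff_add)
      fix v show "Poly_Mapping.lookup (lead m s' bs) v \<le> Poly_Mapping.lookup u v"
        using lead_coprime[OF bs as, of s' s v] column sum[of v] by fastforce
    qed
    then show ?thesis
      using reducible_coprime[OF T _ s' column bs, where u = "u - lead m s' bs" and as = as] adm(1) by metis
  next
    case length
    let ?j = "length bs - 1"
    have "0 < length bs" using bs by (simp add: row_list_def)
    then have j: "Suc ?j < length as" "?j \<noteq> length as - 1" using length(2) by linarith+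
    have "0 < Poly_Mapping.lookup u (YV (front m s ?j) s)"
      using sum[of "YV (front m s ?j) s"] length(1) j by (simp add: lookup_lead_Y)
    then have "u = (u - ymon m s ?j) + ymon m s ?j"
      unfolding ymon_def by (rule monom_single_diff_add)
    then show ?thesis
      using reducible_y[OF T _ j(1), of m "u - ymon m s ?j" s] adm(1) by metis
  next
    case row
    let ?v = "XV (bs ! j) (front m s j)"
    have j: "j < m" using row as row_list_length by fastforce
    have "Poly_Mapping.lookup (lead m s as) ?v = 0"
    proof (rule ccontr)
      assume "Poly_Mapping.lookup (lead m s as) ?v \<noteq> 0"
      then obtain l where "l < length as" "bs ! j = as ! l" "m * s + j = m * s + l"
        using lookup_leadD[OF as] j by fastforce
      then show False using row(4) by simp
    qed
    moreover have "Poly_Mapping.lookup (lead m s bs) ?v = 1"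
      using lookup_lead_X[OF bs, of j] row j by simp
    ultimately have "0 < Poly_Mapping.lookup u ?v" using sum[of ?v] row(1) by simp
    then have u: "u = (u - Poly_Mapping.single ?v 1) + Poly_Mapping.single ?v 1" by (rule monom_single_diff_add)
    have "as ! (j - 1) < bs ! j" if "j > 0"
    proof -
      have "as ! (j - 1) = bs ! (j - 1)" using row(5)[of "j - 1"] that by simp
      also have "\<dots> < bs ! j" using bs row(2,3) that by (auto simp: row_list_def sorted_wrt_iff_nth_less)
      finally show ?thesis .
    qed
    then show ?thesis
      using reducible_row[OF T _ row(3,4), of m "u - Poly_Mapping.single ?v 1" s] u adm(1) by metis
  qed
qed

lemma list_first_difference:
  assumes "length as = length bs" "as \<noteq> bs"
  obtains j where "j < length as" "as ! j \<noteq> bs ! j" "\<And>l. l < j \<Longrightarrow> as ! l = bs ! l"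
proof -
  let ?P = "\<lambda>j. j < length as \<and> as ! j \<noteq> bs ! j"
  have ex: "\<exists>j. ?P j" using assms nth_equalityI by blast
  have before: "as ! l = bs ! l" if "l < (LEAST j. ?P j)" for l
  proof -
    have "(LEAST j. ?P j) < length as" using LeastI_ex[OF ex] by blast
    then show ?thesis using not_less_Least[OF that] that by auto
  qed
  show ?thesis using that LeastI_ex[OF ex] before by blast
qed

text \<open>
  Any two different pairs with the same leading monomial are comparable in the sense of
  \<open>reducible_if_same_lead\<close>, in one direction or the other.
\<close>

lemma irreducible_unique:
  assumes T: "T \<subseteq> {..<n}" and adm: "admissible m n T u s as" "admissible m n T u' s' bs"
    and irr: "\<not> reducible TYPE('k::field) m n T u s as" "\<not> reducible TYPE('k) m n T u' s' bs"
    and same: "u + lead m s as = u' + lead m s' bs"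
  shows "u = u' \<and> s = s' \<and> as = bs"
proof -
  have not1: "\<not> (s' < s \<or> s' = s \<and> (length bs < length as \<or>
      length bs = length as \<and> (\<exists>j<length as. bs ! j < as ! j \<and> (\<forall>l<j. bs ! l = as ! l))))"
    using reducible_if_same_lead[OF T adm same, where 'k = 'k] irr(1) by blast
  have not2: "\<not> (s < s' \<or> s = s' \<and> (length as < length bs \<or>
      length as = length bs \<and> (\<exists>j<length bs. as ! j < bs ! j \<and> (\<forall>l<j. as ! l = bs ! l))))"
    using reducible_if_same_lead[OF T adm(2,1) same[symmetric], where 'k = 'k] irr(2) by blast
  have s: "s = s'" and len: "length as = length bs"
    using not1 not2 by (metis linorder_neqE_nat)+
  have "as = bs"
  proof (rule ccontr)
    assume "as \<noteq> bs"
    then obtain j where j: "j < length as" "as ! j \<noteq> bs ! j" "\<And>l. l < j \<Longrightarrow> as ! l = bs ! l"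
      using list_first_difference[OF len] by metis
    then consider "as ! j < bs ! j" | "bs ! j < as ! j" by linarith
    then show False using not1 not2 s len j by cases fastforce+
  qed
  then show ?thesis using same s by simp
qed

lemma finite_vars_R: "finite (vars_R m n)"
proof -
  have "vars_R m n = (\<lambda>(i, j). XV i j) ` ({..<m} \<times> {..<m * n}) \<union> (\<lambda>(k, l). YV k l) ` ({..<m * n} \<times> {..<n})"
    by (auto simp: vars_R_def image_iff)
  then show ?thesis by simp
qed

lemma keys_lead_vars:
  assumes s: "s < n" and as: "row_list m as"
  shows "Poly_Mapping.keys (lead m s as) \<subseteq> vars_R m n"
proof -
  have "length as \<le> m * n" using row_list_length[OF as] block_le[OF s] by (rule order_trans)
  moreover have "length as \<noteq> 0" using as by (simp add: row_list_def)
  ultimately have "set [0..<length as] \<subseteq> {..<m * n}" "length as - 1 < m * n"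
    by (simp add: subset_eq, linarith)
  then show ?thesis
    using keys_ymon_vars[OF s] keys_xmon_vars[OF s] as by (simp add: lead_def keys_add_monom row_list_def)
qed

lemma wf_lower:
  assumes T: "T \<subseteq> {..<n}"
  shows "wf {((u', s', as'), (u, s, as)). admissible m n T u' s' as' \<and> admissible m n T u s as \<and> lower m u' s' as' u s as}"
proof -
  obtain vs where vs: "set vs = vars_R m n" "sorted_wrt (var_gt m) vs"
    by (rule sorted_vars_exist[OF finite_vars_R])
  define \<Phi> where "\<Phi> = (\<lambda>(u, s, as). (map (Poly_Mapping.lookup (u + lead m s as)) vs, s, length as, sum_list as))"
  have keys: "Poly_Mapping.keys (u + lead m s as) \<subseteq> set vs" if "admissible m n T u s as" for u s as
    using that T keys_lead_vars[of s n m as] by (auto simp: admissible_def keys_add_monom vs(1))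
  have "(\<Phi> (u', s', as'), \<Phi> (u, s, as)) \<in> lex less_than <*lex*> less_than <*lex*> less_than <*lex*> less_than"
    if "admissible m n T u' s' as'" "admissible m n T u s as" "lower m u' s' as' u s as" for u' s' as' u s as
    using that(3) lex_less_imp_lex[OF vs(2) keys[OF that(1)] keys[OF that(2)]]
    unfolding lower_def \<Phi>_def by auto
  moreover have "wf (inv_image (lex less_than <*lex*> less_than <*lex*> less_than <*lex*> less_than) \<Phi>)"
    by (intro wf_inv_image wf_lex_prod wf_lex wf_less_than)
  ultimately show ?thesis by (elim wf_subset) (auto simp: inv_image_def)
qed

definition irreducibles :: "nat \<Rightarrow> nat \<Rightarrow> nat set \<Rightarrow> ('k::field) mpoly set" where
  "irreducibles m n T =
     {f_multiple m n u s as | u s as. admissible m n T u s as \<and> \<not> reducible TYPE('k) m n T u s as}"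

lemma f_multiple_in_span_irreducibles:
  assumes T: "T \<subseteq> {..<n}"
  shows "admissible m n T u s as \<Longrightarrow> (f_multiple m n u s as :: 'k::field mpoly) \<in> mp.span (irreducibles m n T)"
proof (induction "(u, s, as)" arbitrary: u s as rule: wf_induct_rule[OF wf_lower[OF T, of m]])
  case (1 u s as)
  show ?case
  proof (cases "reducible TYPE('k) m n T u s as")
    case True
    have "below m n T u s as \<subseteq> mp.span (irreducibles m n T :: 'k mpoly set)"
      using 1 by (auto simp: below_def)
    then have "mp.span (below m n T u s as) \<subseteq> mp.span (irreducibles m n T :: 'k mpoly set)"
      by (rule mp.span_minimal) (rule mp.subspace_span)
    then show ?thesis using True by (auto simp: reducible_def)
  next
    case False
    then show ?thesis using 1 by (intro mp.span_base) (auto simp: irreducibles_def)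
  qed
qed

definition multiples :: "nat \<Rightarrow> nat \<Rightarrow> nat set \<Rightarrow> ('k::field) mpoly set" where
  "multiples m n T = {f_multiple m n u s as | u s as. admissible m n T u s as}"

lemma is_lead_f_multiple:
  "T \<subseteq> {..<n} \<Longrightarrow> admissible m n T u s as \<Longrightarrow>
   is_lead m (f_multiple m n u s as :: 'k::field mpoly) (u + lead m s as)"
  unfolding f_multiple_def by (intro is_lead_mon_mult is_lead_f_poly) (auto simp: admissible_def)

text \<open>
  Irreducible multiples span all multiples and have pairwise different leading monomials, so
  \<open>span_lead\<close> applies to them.
\<close>

lemma lead_of_span_multiples:
  assumes T: "T \<subseteq> {..<n}" and f: "(f :: 'k::field mpoly) \<in> mp.span (multiples m n T)" "f \<noteq> 0"
  obtains u s as where "admissible m n T u s as" "lead_mon m f = u + lead m s as"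
proof -
  have "multiples m n T \<subseteq> mp.span (irreducibles m n T :: 'k mpoly set)"
    using f_multiple_in_span_irreducibles[OF T] by (auto simp: multiples_def)
  then have "mp.span (multiples m n T) \<subseteq> mp.span (irreducibles m n T :: 'k mpoly set)"
    by (rule mp.span_minimal) (rule mp.subspace_span)
  then have f': "f \<in> mp.span (irreducibles m n T)" using f by blast
  have lead: "lead_mon m (f_multiple m n u s as :: 'k mpoly) = u + lead m s as" if "admissible m n T u s as" for u s as
    by (rule lead_mon_eq[OF is_lead_f_multiple[OF T that]])
  have "\<exists>p\<in>irreducibles m n T. is_lead m f (lead_mon m (p :: 'k mpoly))"
  proof (rule span_lead[OF _ _ f' f(2)])
    fix p :: "'k mpoly" assume "p \<in> irreducibles m n T"
    then show "is_lead m p (lead_mon m p)"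
      using is_lead_f_multiple[OF T] lead by (auto simp: irreducibles_def)
  next
    show "inj_on (lead_mon m) (irreducibles m n T :: 'k mpoly set)"
    proof (rule inj_onI)
      fix p q :: "'k mpoly"
      assume "p \<in> irreducibles m n T" "q \<in> irreducibles m n T" and eq: "lead_mon m p = lead_mon m q"
      then obtain u s as u' s' bs where
        p: "p = f_multiple m n u s as" "admissible m n T u s as" "\<not> reducible TYPE('k) m n T u s as" and
        q: "q = f_multiple m n u' s' bs" "admissible m n T u' s' bs" "\<not> reducible TYPE('k) m n T u' s' bs"
        by (auto simp: irreducibles_def)
      have "u + lead m s as = u' + lead m s' bs" using eq lead p q by simp
      then show "p = q" using irreducible_unique[OF T p(2) q(2) p(3) q(3)] p q by simp
    qed
  qed
  then show ?thesis using that lead lead_mon_eq[of m f] by (auto simp: irreducibles_def)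
qed

section \<open>The ring and its ideals\<close>

lemma carrier_poly_R: "carrier (poly_R m n) = {p. \<forall>\<mu>\<in>Poly_Mapping.keys p. Poly_Mapping.keys \<mu> \<subseteq> vars_R m n}"
  and poly_R_simps [simp]: "add (poly_R m n) = (+)" "monoid.mult (poly_R m n) = (*)"
    "zero (poly_R m n) = 0" "one (poly_R m n) = 1"
  by (simp_all add: poly_R_def)

lemma add_carrier: "p \<in> carrier (poly_R m n) \<Longrightarrow> q \<in> carrier (poly_R m n) \<Longrightarrow> p + q \<in> carrier (poly_R m n)"
  using keys_add[of p q] by (auto simp: carrier_poly_R)

lemma mult_carrier: "p \<in> carrier (poly_R m n) \<Longrightarrow> q \<in> carrier (poly_R m n) \<Longrightarrow> p * q \<in> carrier (poly_R m n)"
  using keys_mult[of p q] by (force simp: carrier_poly_R keys_add_monom)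

lemma uminus_carrier: "p \<in> carrier (poly_R m n) \<Longrightarrow> - p \<in> carrier (poly_R m n)"
  by (simp add: carrier_poly_R)

lemma mon_carrier: "mon u \<in> carrier (poly_R m n) \<longleftrightarrow> Poly_Mapping.keys u \<subseteq> vars_R m n"
  by (simp add: carrier_poly_R)

lemma zero_carrier: "0 \<in> carrier (poly_R m n)"
  by (simp add: carrier_poly_R)

lemma one_carrier: "1 \<in> carrier (poly_R m n)"
  using mon_carrier[of 0] by simp

lemma poly_R_ring: "ring (poly_R m n :: ('k::field) mpoly ring)"
proof (rule ringI)
  show "abelian_group (poly_R m n :: 'k mpoly ring)"
  proof (rule abelian_groupI)
    fix p :: "'k mpoly" assume "p \<in> carrier (poly_R m n)"
    then show "\<exists>q\<in>carrier (poly_R m n). q \<oplus>\<^bsub>poly_R m n\<^esub> p = \<zero>\<^bsub>poly_R m n\<^esub>"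
      by (intro bexI[of _ "- p"]) (simp_all add: uminus_carrier)
  qed (simp_all add: add_carrier zero_carrier ac_simps)
  show "Group.monoid (poly_R m n :: 'k mpoly ring)"
    by (rule monoidI) (simp_all add: mult_carrier one_carrier ac_simps)
qed (simp_all add: algebra_simps)

lemma ideal_poly_RI:
  fixes I :: "('k::field) mpoly set"
  assumes "I \<subseteq> carrier (poly_R m n)" "0 \<in> I" "\<And>p q. p \<in> I \<Longrightarrow> q \<in> I \<Longrightarrow> p + q \<in> I"
    and mult: "\<And>h p. h \<in> carrier (poly_R m n) \<Longrightarrow> p \<in> I \<Longrightarrow> h * p \<in> I"
  shows "ideal I (poly_R m n)"
proof (rule idealI[OF poly_R_ring])
  interpret R: ring "poly_R m n :: 'k mpoly ring" by (rule poly_R_ring)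
  have "- p \<in> I" if "p \<in> I" for p using mult[OF uminus_carrier[OF one_carrier] that] by simp
  moreover have "\<ominus>\<^bsub>poly_R m n\<^esub> p = - p" if "p \<in> carrier (poly_R m n)" for p :: "'k mpoly"
    using that by (intro R.minus_equality) (simp_all add: uminus_carrier)
  ultimately show "subgroup I (add_monoid (poly_R m n))"
    using assms by (intro R.add.subgroupI) (auto simp: a_inv_def[symmetric])
  fix p h :: "'k mpoly" assume "p \<in> I" "h \<in> carrier (poly_R m n)"
  then show "h \<otimes>\<^bsub>poly_R m n\<^esub> p \<in> I" "p \<otimes>\<^bsub>poly_R m n\<^esub> h \<in> I"
    using mult[of h p] by (simp_all add: mult.commute)
qed

lemma ideal_poly_RD:
  assumes "ideal I (poly_R m n :: ('k::field) mpoly ring)"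
  shows "I \<subseteq> carrier (poly_R m n)" "0 \<in> I" "p \<in> I \<Longrightarrow> q \<in> I \<Longrightarrow> p + q \<in> I"
    "h \<in> carrier (poly_R m n) \<Longrightarrow> p \<in> I \<Longrightarrow> h * p \<in> I"
proof -
  note sub = ideal.axioms(1)[OF assms]
  show "I \<subseteq> carrier (poly_R m n)" by (rule additive_subgroup.a_subset[OF sub])
  show "0 \<in> I" using additive_subgroup.zero_closed[OF sub] by simp
  show "p \<in> I \<Longrightarrow> q \<in> I \<Longrightarrow> p + q \<in> I" using additive_subgroup.a_closed[OF sub, of p q] by simp
  show "h \<in> carrier (poly_R m n) \<Longrightarrow> p \<in> I \<Longrightarrow> h * p \<in> I" using ideal.I_l_closed[OF assms, of p h] by simp
qed

lemma ideal_sum: "ideal I (poly_R m n :: ('k::field) mpoly ring) \<Longrightarrow> (\<And>i. i \<in> A \<Longrightarrow> f i \<in> I) \<Longrightarrow> sum f A \<in> I"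
  by (induction A rule: infinite_finite_induct) (auto simp: ideal_poly_RD)

lemmas genideal_ideal = ring.genideal_ideal[OF poly_R_ring]
lemmas genideal_self = ring.genideal_self[OF poly_R_ring]
lemmas genideal_minimal = ring.genideal_minimal[OF poly_R_ring]

lemma X_var_carrier: "i < m \<Longrightarrow> p < m * n \<Longrightarrow> s < n \<Longrightarrow> Var (XV i (front m s p)) \<in> carrier (poly_R m n)"
  by (simp add: Var_eq_mon mon_carrier xvar_in_vars)

lemma Y_var_carrier: "p < m * n \<Longrightarrow> s < n \<Longrightarrow> Var (YV (front m s p) s) \<in> carrier (poly_R m n)"
  using keys_ymon_vars by (simp add: Var_eq_mon mon_carrier ymon_def)

lemma sum_carrier: "(\<And>i. i \<in> A \<Longrightarrow> f i \<in> carrier (poly_R m n)) \<Longrightarrow> sum f A \<in> carrier (poly_R m n)"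
  by (induction A rule: infinite_finite_induct) (simp_all add: add_carrier zero_carrier)

lemma entry_carrier: "i < m \<Longrightarrow> s < n \<Longrightarrow> entry m n s i \<in> carrier (poly_R m n)"
  by (auto simp: entry_def intro!: sum_carrier mult_carrier X_var_carrier Y_var_carrier)

lemma elements_column:
  assumes s: "s < n"
  shows "elements_mat (X_at m n s * Y_at m n s) = (entry m n s ` {..<m} :: 'k::field mpoly set)"
proof -
  have dims: "dim_row (X_at m n s :: 'k mpoly mat) = m" "dim_col (X_at m n s :: 'k mpoly mat) = m * n"
    "dim_row (Y_at m n s :: 'k mpoly mat) = m * n" "dim_col (Y_at m n s :: 'k mpoly mat) = 1"
    by (simp_all add: X_at_def Y_at_def)
  then have dim: "X_at m n s * (Y_at m n s :: 'k mpoly mat) \<in> carrier_mat m 1" by auto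
  have eq: "(X_at m n s * Y_at m n s) $$ (i, 0) = (entry m n s i :: 'k mpoly)" if i: "i < m" for i
  proof -
    have "(X_at m n s * Y_at m n s) $$ (i, 0) = (\<Sum>p = 0..<m * n. X_at m n s $$ (i, p) * (Y_at m n s $$ (p, 0) :: 'k mpoly))"
      using i dims by (simp add: scalar_prod_def)
    then show ?thesis
      by (simp add: entry_def X_at_entry[OF s i] Y_at_entry[OF s] atLeast0LessThan)
  qed
  show ?thesis
  proof (intro equalityI subsetI)
    fix a :: "'k mpoly" assume "a \<in> elements_mat (X_at m n s * Y_at m n s)"
    then obtain i where "i < m" "a = (X_at m n s * Y_at m n s) $$ (i, 0)"
      using elements_matD[of a] carrier_matD[OF dim] by (metis less_one)
    then show "a \<in> entry m n s ` {..<m}" unfolding eq[OF \<open>i < m\<close>] by blast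
  next
    fix a :: "'k mpoly" assume "a \<in> entry m n s ` {..<m}"
    then obtain i where "i < m" "a = (X_at m n s * Y_at m n s) $$ (i, 0)" using eq by auto
    then show "a \<in> elements_mat (X_at m n s * Y_at m n s)" by (intro elements_matI[OF dim, of i 0]) simp_all
  qed
qed

lemma elements_XY: "elements_mat (mat_X m n * mat_Y m n) = (\<Union>s<n. entry m n s ` {..<m} :: 'k::field mpoly set)"
proof -
  have dims: "dim_row (mat_X m n :: 'k mpoly mat) = m" "dim_col (mat_X m n :: 'k mpoly mat) = m * n"
    "dim_row (mat_Y m n :: 'k mpoly mat) = m * n" "dim_col (mat_Y m n :: 'k mpoly mat) = n"
    by (simp_all add: mat_X_def mat_Y_def)
  then have dim: "mat_X m n * (mat_Y m n :: 'k mpoly mat) \<in> carrier_mat m n" by auto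
  have eq: "(mat_X m n * mat_Y m n) $$ (i, s) = (entry m n s i :: 'k mpoly)" if i: "i < m" "s < n" for i s
  proof -
    have "(mat_X m n * mat_Y m n) $$ (i, s) = (\<Sum>p<m * n. Var (XV i p) * (Var (YV p s) :: 'k mpoly))"
      using i by (simp add: mat_X_def mat_Y_def scalar_prod_def atLeast0LessThan)
    also have "\<dots> = entry m n s i"
      unfolding entry_def using sum.reindex_bij_betw[OF front_bij[OF i(2), of m], symmetric] .
    finally show ?thesis .
  qed
  show ?thesis
  proof (intro equalityI subsetI)
    fix a :: "'k mpoly" assume "a \<in> elements_mat (mat_X m n * mat_Y m n)"
    then obtain i s where idx: "i < m" "s < n" "a = (mat_X m n * mat_Y m n) $$ (i, s)"
      using elements_matD[of a] carrier_matD[OF dim] by metis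
    then show "a \<in> (\<Union>s<n. entry m n s ` {..<m})" unfolding eq[OF idx(1,2)] by blast
  next
    fix a :: "'k mpoly" assume "a \<in> (\<Union>s<n. entry m n s ` {..<m})"
    then obtain i s where "i < m" "s < n" "a = (mat_X m n * mat_Y m n) $$ (i, s)" using eq by auto
    then show "a \<in> elements_mat (mat_X m n * mat_Y m n)" by (intro elements_matI[OF dim]) simp_all
  qed
qed

text \<open>
  Expanding along all ordinary columns leaves a combination of entries of the special column.
  Doing this one column at a time avoids having to know that cofactors lie in the ring.
\<close>

lemma f_aug_in_ideal:
  assumes I: "ideal I (poly_R m n :: ('k::field) mpoly ring)" and s: "s < n"
    and entry: "\<And>i. i < m \<Longrightarrow> (entry m n s i :: 'k mpoly) \<in> I"
  shows "length as = Suc (length cs) \<Longrightarrow> set as \<subseteq> {..<m} \<Longrightarrow> set cs \<subseteq> {..<m * n} \<Longrightarrow> f_aug m n s as cs \<in> I"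
proof (induction cs arbitrary: as rule: rev_induct)
  case Nil
  then obtain a where a: "as = [a]" by (auto simp: length_Suc_conv)
  have "f_aug m n s [a] [] = (entry m n s a :: 'k mpoly)"
    unfolding f_aug_def aug_det_def by (subst det_single) simp_all
  then show ?case using a Nil.prems entry[of a] by simp
next
  case (snoc c cs)
  have len: "length as = Suc (Suc (length cs))" using snoc.prems by simp
  have sign: "(-1) ^ e * p \<in> I" if "p \<in> I" for e p
    using that ideal_poly_RD(4)[OF I uminus_carrier[OF one_carrier] that] by (cases "even e") simp_all
  show ?case
    unfolding f_aug_def aug_det_expand[OF len]
  proof (intro ideal_sum[OF I] sign ideal_poly_RD(4)[OF I])
    fix l assume "l \<in> {..<length as}"
    then have l: "l < length as" by simp
    then have "as ! l < m" using snoc.prems nth_mem by blast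
    then show "Var (XV (as ! l) (front m s c)) \<in> carrier (poly_R m n)"
      using snoc.prems s by (intro X_var_carrier) auto
    show "aug_det (\<lambda>i p. Var (XV i (front m s p))) (entry m n s) (delete_at l as) cs \<in> I"
      using snoc.prems l set_delete_at[of l as]
      by (intro snoc.IH[unfolded f_aug_def]) auto
  qed
qed

lemma G_set_subset_ideal:
  assumes I: "ideal I (poly_R m n :: ('k::field) mpoly ring)" and s: "s < n"
    and entry: "entry m n s ` {..<m} \<subseteq> (I :: 'k mpoly set)"
  shows "G_set m n s \<subseteq> I"
proof
  fix f :: "'k mpoly" assume "f \<in> G_set m n s"
  then obtain as where f: "f = f_poly m n s as" and as: "row_list m as" by (auto simp: G_set_eq)
  have "length as \<noteq> 0" "length as \<le> m * n"
    using as order_trans[OF row_list_length[OF as] block_le[OF s]] by (auto simp: row_list_def)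
  then have "length as = Suc (length [0..<length as - 1])" "set [0..<length as - 1] \<subseteq> {..<m * n}"
    by (auto simp del: length_0_conv)
  then show "f \<in> I"
    unfolding f f_poly_eq_f_aug[OF s as] using as entry
    by (intro f_aug_in_ideal[OF I s]) (auto simp: row_list_def)
qed

lemma entry_eq_f_poly:
  assumes s: "s < n" and i: "i < m"
  shows "entry m n s i = (f_poly m n s [i] :: 'k::field mpoly)"
proof -
  have "row_list m [i]" using i by (simp add: row_list_def)
  from f_poly_eq_f_aug[OF s this, where 'k = 'k] show ?thesis
    unfolding f_aug_def aug_det_def by (simp add: det_single)
qed

text \<open>The span of all the multiples absorbs multiplication, so it contains the ideal.\<close>

lemma ideal_subset_span:
  assumes T: "T \<subseteq> {..<n}" and I: "I = genideal (poly_R m n) S"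
    and S: "S \<subseteq> (\<Union>s\<in>T. entry m n s ` {..<m})"
  shows "(I :: 'k::field mpoly set) \<subseteq> mp.span (multiples m n T)"
proof -
  let ?V = "carrier (poly_R m n) \<inter> mp.span (multiples m n T) :: 'k mpoly set"
  have "ideal ?V (poly_R m n)"
  proof (rule ideal_poly_RI)
    fix h p :: "'k mpoly" assume h: "h \<in> carrier (poly_R m n)" and p: "p \<in> ?V"
    have "h * p \<in> mp.span (multiples m n T)"
    proof (rule mult_span)
      show "p \<in> mp.span (multiples m n T)" using p by simp
      fix q :: "'k mpoly" assume "q \<in> multiples m n T"
      then obtain u s as where q: "q = f_multiple m n u s as" "admissible m n T u s as" by (auto simp: multiples_def)
      show "h * q \<in> mp.span (multiples m n T)"
      proof (rule mult_in_span)
        fix \<kappa> assume "\<kappa> \<in> Poly_Mapping.keys h"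
        then have "admissible m n T (\<kappa> + u) s as"
          using h q(2) by (auto simp: admissible_def keys_add_monom carrier_poly_R)
        moreover have "mon \<kappa> * q = f_multiple m n (\<kappa> + u) s as"
          by (simp add: q f_multiple_def mon_mult flip: mult.assoc)
        ultimately show "mon \<kappa> * q \<in> mp.span (multiples m n T)"
          by (intro mp.span_base) (auto simp: multiples_def)
      qed
    qed
    then show "h * p \<in> ?V" using h p by (simp add: mult_carrier)
  qed (auto simp: add_carrier zero_carrier mp.span_zero mp.span_add)
  moreover have "S \<subseteq> ?V"
  proof
    fix a assume "a \<in> S"
    then obtain s i where s: "s \<in> T" "i < m" and a: "a = entry m n s i" using S by auto
    have "s < n" using s T by auto
    then have "a = f_multiple m n 0 s [i]" by (simp add: a f_multiple_def entry_eq_f_poly s)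
    moreover have "admissible m n T 0 s [i]" using s by (simp add: admissible_def row_list_def)
    ultimately have "a \<in> mp.span (multiples m n T)" by (intro mp.span_base) (auto simp: multiples_def)
    then show "a \<in> ?V" using entry_carrier[OF s(2) \<open>s < n\<close>] a by simp
  qed
  ultimately have "genideal (poly_R m n) S \<subseteq> ?V" by (rule genideal_minimal)
  then show ?thesis using I by simp
qed

section \<open>Reduced Groebner bases\<close>

text \<open>
  A monomial of a generator has a single \<open>y\<close>-variable, at a position not before its size, and one
  \<open>x\<close>-variable in each of its rows.  The \<open>y\<close>-variable of a divisor forces the same column of \<open>Y\<close> and
  at least the same size, the \<open>x\<close>-variables force its rows to be among the given ones.
\<close>

lemma lead_not_dvd_key:
  assumes s: "s < n" and as: "row_list m as" and bs: "row_list m bs"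
    and \<mu>: "\<mu> \<in> Poly_Mapping.keys (f_poly m n s as :: 'k::field mpoly)" and dvd: "mon_dvd (lead m s' bs) \<mu>"
  shows "s' = s \<and> bs = as"
proof -
  obtain ts p where p: "length as - 1 \<le> p" "mset ts = mset ([0..<length as - 1] @ [p])"
    and \<mu>: "\<mu> = ymon m s p + xmon m s as ts"
    by (rule keys_f_poly[OF s as \<mu>])
  have ne: "as \<noteq> []" "bs \<noteq> []" using as bs by (auto simp: row_list_def)
  have dist: "distinct as" "distinct bs" using as bs by (auto simp: row_list_def strict_sorted_iff)
  have len: "length as = length ts" using mset_eq_length[OF p(2)] ne by simp
  have le: "Poly_Mapping.lookup (lead m s' bs) v \<le> Poly_Mapping.lookup \<mu> v" for v
    using dvd by (simp add: mon_dvd_def)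
  have "Poly_Mapping.lookup \<mu> (YV (front m s' (length bs - 1)) s') \<noteq> 0"
    using le[of "YV (front m s' (length bs - 1)) s'"] by (simp add: lookup_lead_Y)
  then have "YV (front m s' (length bs - 1)) s' = YV (front m s p) s"
    using len by (simp add: \<mu> lookup_add lookup_ymon split: if_splits)
  then have s': "s' = s" and "length bs - 1 = p" by auto
  then have "length as \<le> length bs" using p(1) ne by (cases as; cases bs) auto
  have "set bs \<subseteq> set as"
  proof
    fix b assume "b \<in> set bs"
    then obtain l where l: "l < length bs" "b = bs ! l" by (auto simp: in_set_conv_nth)
    then have "Poly_Mapping.lookup \<mu> (XV b (m * s' + l)) \<noteq> 0"
      using le[of "XV b (m * s' + l)"] lookup_lead_X[OF bs, of l s'] by simp
    then show "b \<in> set as"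
      using lookup_xmon_notin[OF len, of b] by (fastforce simp: \<mu> lookup_add lookup_ymon)
  qed
  moreover have "card (set as) \<le> card (set bs)"
    using \<open>length as \<le> length bs\<close> dist by (simp add: distinct_card)
  ultimately have "set bs = set as" by (intro card_seteq) auto
  then have "bs = as"
    using as bs by (auto simp: row_list_def intro: strict_sorted_equal)
  with s' show ?thesis by simp
qed

lemma finite_G_set: "finite (G_set m n s)"
proof -
  have "{as. row_list m as} \<subseteq> {as. set as \<subseteq> {..<m} \<and> length as \<le> m}"
    using row_list_length by (auto simp: row_list_def)
  then have "finite {as. row_list m as}" by (rule finite_subset) (simp add: finite_lists_length_le)
  then show ?thesis by (simp add: G_set_eq)
qed

text \<open>
  The ideal enters only through two inclusions: it contains the generators, and it lies in the
  span of their multiples.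
\<close>

theorem reduced_groebner_basis:
  assumes T: "T \<subseteq> {..<n}" and I: "ideal I (poly_R m n :: ('k::field) mpoly ring)"
    and G: "\<And>s. s \<in> T \<Longrightarrow> G_set m n s \<subseteq> I" and span: "I \<subseteq> mp.span (multiples m n T)"
  shows "is_reduced_groebner_basis m n (\<Union>s\<in>T. G_set m n s) I"
proof -
  let ?G = "\<Union>s\<in>T. G_set m n s :: 'k mpoly set"
  have lead: "is_lead m (f_poly m n s as :: 'k mpoly) (lead m s as)"
    "lead_mon m (f_poly m n s as :: 'k mpoly) = lead m s as"
    "lead_coef m (f_poly m n s as :: 'k mpoly) = 1"
    "(f_poly m n s as :: 'k mpoly) \<noteq> 0" if "s \<in> T" "row_list m as" for s as
  proof -
    have s: "s < n" using that T by auto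
    show 1: "is_lead m (f_poly m n s as :: 'k mpoly) (lead m s as)" by (rule is_lead_f_poly(1)[OF s that(2)])
    then show 2: "lead_mon m (f_poly m n s as :: 'k mpoly) = lead m s as" by (rule lead_mon_eq)
    show "lead_coef m (f_poly m n s as :: 'k mpoly) = 1" using is_lead_f_poly(2)[OF s that(2)] by (simp add: lead_coef_def 2)
    show "(f_poly m n s as :: 'k mpoly) \<noteq> 0" using 1 by (auto simp: is_lead_def)
  qed
  define leads where "leads F = {mon (lead_mon m f) :: 'k mpoly | f. f \<in> F \<and> f \<noteq> 0}" for F :: "'k mpoly set"
  have init: "initial_ideal m n F = genideal (poly_R m n) (leads F)" for F :: "'k mpoly set"
    by (simp add: initial_ideal_def leads_def mon_def)
  have "finite T" using T by (rule finite_subset) simp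
  then have fin: "finite ?G" by (simp add: finite_G_set)
  have sub: "?G \<subseteq> I" using G by blast
  have dvd: "\<exists>u s as. admissible m n T u s as \<and> lead_mon m f = u + lead m s as" if "f \<in> I" "f \<noteq> 0" for f
  proof -
    have "f \<in> mp.span (multiples m n T)" using that span by blast
    then show ?thesis using lead_of_span_multiples[OF T _ that(2)] by metis
  qed
  have carrier: "leads I \<subseteq> carrier (poly_R m n)"
  proof
    fix p assume "p \<in> leads I"
    then obtain f where p: "p = mon (lead_mon m f)" "f \<in> I" "f \<noteq> 0" by (auto simp: leads_def)
    then obtain u s as where "admissible m n T u s as" "lead_mon m f = u + lead m s as" using dvd by blast
    then show "p \<in> carrier (poly_R m n)"
      using keys_lead_vars[of s n m as] T by (auto simp: p mon_carrier keys_add_monom admissible_def)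
  qed
  have "leads ?G \<subseteq> leads I" using sub unfolding leads_def by blast
  have "genideal (poly_R m n) (leads ?G) = genideal (poly_R m n) (leads I)"
  proof
    have "leads ?G \<subseteq> genideal (poly_R m n) (leads I)"
      using \<open>leads ?G \<subseteq> leads I\<close> genideal_self[OF carrier] by blast
    then show "genideal (poly_R m n) (leads ?G) \<subseteq> genideal (poly_R m n) (leads I)"
      by (rule genideal_minimal[OF genideal_ideal[OF carrier]])
  next
    have carrier': "leads ?G \<subseteq> carrier (poly_R m n)" using \<open>leads ?G \<subseteq> leads I\<close> carrier by blast
    have "leads I \<subseteq> genideal (poly_R m n) (leads ?G)"
    proof
      fix p assume "p \<in> leads I"
      then obtain f where p: "p = mon (lead_mon m f)" "f \<in> I" "f \<noteq> 0" by (auto simp: leads_def)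
      then obtain u s as where adm: "admissible m n T u s as" and u: "lead_mon m f = u + lead m s as" using dvd by blast
      then have s: "s \<in> T" "row_list m as" by (auto simp: admissible_def)
      then have "mon (lead m s as) \<in> leads ?G"
        using s lead(2,4)[OF s] unfolding leads_def G_set_eq
        by (intro CollectI exI[of _ "f_poly m n s as"] conjI UN_I[of s] imageI) simp_all
      then have "mon (lead m s as) \<in> genideal (poly_R m n) (leads ?G)" using genideal_self[OF carrier'] by blast
      then have "mon u * mon (lead m s as) \<in> genideal (poly_R m n) (leads ?G)"
        using adm by (intro ideal_poly_RD(4)[OF genideal_ideal[OF carrier']]) (simp_all add: mon_carrier admissible_def)
      then show "p \<in> genideal (poly_R m n) (leads ?G)" by (simp add: p u mon_mult)
    qed
    then show "genideal (poly_R m n) (leads I) \<subseteq> genideal (poly_R m n) (leads ?G)"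
      by (rule genideal_minimal[OF genideal_ideal[OF carrier']])
  qed
  moreover have "0 \<notin> ?G" using lead(4) by (auto simp: G_set_eq)
  ultimately have "is_groebner_basis m n ?G I" using fin sub by (simp add: is_groebner_basis_def init)
  moreover have "lead_coef m g = 1 \<and> (\<forall>h\<in>?G - {g}. \<forall>\<mu>\<in>Poly_Mapping.keys g. \<not> mon_dvd (lead_mon m h) \<mu>)" if g_in: "g \<in> ?G" for g
  proof -
    obtain s as where g: "g = f_poly m n s as" "s \<in> T" "row_list m as" using g_in by (auto simp: G_set_eq)
    have "\<not> mon_dvd (lead_mon m h) \<mu>" if h: "h \<in> ?G - {g}" and \<mu>: "\<mu> \<in> Poly_Mapping.keys g" for h \<mu>
    proof
      assume dvd: "mon_dvd (lead_mon m h) \<mu>"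
      obtain s' bs where h': "h = f_poly m n s' bs" "s' \<in> T" "row_list m bs" using h by (auto simp: G_set_eq)
      have "s < n" using g T by auto
      then have "s' = s \<and> bs = as"
        using lead_not_dvd_key[OF _ g(3) h'(3), of s n \<mu> s', where 'k = 'k] dvd \<mu> lead(2) g h' by simp
      then show False using g h' h by simp
    qed
    then show ?thesis using lead(3) g by blast
  qed
  ultimately show ?thesis by (simp add: is_reduced_groebner_basis_def)
qed

lemma I1_column_ideal:
  assumes s: "s < n"
  shows "ideal (I1 m n (X_at m n s * Y_at m n s)) (poly_R m n :: ('k::field) mpoly ring)"
    and "entry m n s ` {..<m} \<subseteq> (I1 m n (X_at m n s * Y_at m n s) :: 'k mpoly set)"
  using entry_carrier[OF _ s] unfolding I1_def elements_column[OF s]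
  by (auto intro!: genideal_ideal genideal_self[THEN subsetD])

lemma I1_XY_ideal:
  shows "ideal (I1 m n (mat_X m n * mat_Y m n)) (poly_R m n :: ('k::field) mpoly ring)"
    and "s < n \<Longrightarrow> entry m n s ` {..<m} \<subseteq> (I1 m n (mat_X m n * mat_Y m n) :: 'k mpoly set)"
proof -
  have sub: "(\<Union>s<n. entry m n s ` {..<m}) \<subseteq> (carrier (poly_R m n) :: 'k mpoly set)" using entry_carrier by auto
  show "ideal (I1 m n (mat_X m n * mat_Y m n)) (poly_R m n :: 'k mpoly ring)"
    unfolding I1_def elements_XY by (rule genideal_ideal[OF sub])
  show "s < n \<Longrightarrow> entry m n s ` {..<m} \<subseteq> (I1 m n (mat_X m n * mat_Y m n) :: 'k mpoly set)"
    unfolding I1_def elements_XY using genideal_self[OF sub] by blast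
qed

lemma P_ideal_ideal:
  assumes t: "t \<le> n"
  shows "ideal (P_ideal m n t) (poly_R m n :: ('k::field) mpoly ring)"
proof (rule ideal_poly_RI)
  have col: "ideal (I1 m n (X_at m n s * Y_at m n s)) (poly_R m n :: 'k mpoly ring)" if "s < t" for s
    using that t by (intro I1_column_ideal) simp
  show "P_ideal m n t \<subseteq> (carrier (poly_R m n) :: 'k mpoly set)"
    using ideal_poly_RD(1)[OF col] by (auto simp: P_ideal_def intro!: sum_carrier)
  show "(0 :: 'k mpoly) \<in> P_ideal m n t"
    using ideal_poly_RD(2)[OF col] by (auto simp: P_ideal_def intro!: exI[of _ "\<lambda>_. 0"])
  fix p q :: "'k mpoly" assume "p \<in> P_ideal m n t" "q \<in> P_ideal m n t"
  then obtain g h where p: "p = (\<Sum>s<t. g s)" "\<And>s. s < t \<Longrightarrow> g s \<in> I1 m n (X_at m n s * Y_at m n s)"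
    and q: "q = (\<Sum>s<t. h s)" "\<And>s. s < t \<Longrightarrow> h s \<in> I1 m n (X_at m n s * Y_at m n s)"
    by (auto simp: P_ideal_def)
  have "p + q = (\<Sum>s<t. g s + h s)" by (simp add: p q sum.distrib)
  then show "p + q \<in> P_ideal m n t"
    using ideal_poly_RD(3)[OF col] p(2) q(2) unfolding P_ideal_def by blast
next
  have col: "ideal (I1 m n (X_at m n s * Y_at m n s)) (poly_R m n :: 'k mpoly ring)" if "s < t" for s
    using that t by (intro I1_column_ideal) simp
  fix h p :: "'k mpoly" assume h: "h \<in> carrier (poly_R m n)" and "p \<in> P_ideal m n t"
  then obtain g where p: "p = (\<Sum>s<t. g s)" "\<And>s. s < t \<Longrightarrow> g s \<in> I1 m n (X_at m n s * Y_at m n s)"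
    by (auto simp: P_ideal_def)
  have "h * p = (\<Sum>s<t. h * g s)" by (simp add: p sum_distrib_left)
  then show "h * p \<in> P_ideal m n t"
    using ideal_poly_RD(4)[OF col h] p(2) unfolding P_ideal_def by blast
qed

lemma I1_column_subset_P_ideal:
  assumes t: "t \<le> n" and s: "s < t"
  shows "I1 m n (X_at m n s * Y_at m n s) \<subseteq> (P_ideal m n t :: 'k::field mpoly set)"
proof
  fix p :: "'k mpoly" assume p: "p \<in> I1 m n (X_at m n s * Y_at m n s)"
  define g where "g s' = (if s' = s then p else 0)" for s'
  have "p = (\<Sum>s'<t. g s')" using s by (simp add: g_def)
  moreover have "g s' \<in> I1 m n (X_at m n s' * Y_at m n s')" if "s' < t" for s'
    using that t p ideal_poly_RD(2)[OF I1_column_ideal(1), where 'k = 'k] by (simp add: g_def)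
  ultimately show "p \<in> P_ideal m n t" unfolding P_ideal_def by blast
qed

lemma P_ideal_eq_I1: "P_ideal m n n = (I1 m n (mat_X m n * mat_Y m n) :: 'k::field mpoly set)"
proof
  have "I1 m n (X_at m n s * Y_at m n s) \<subseteq> (I1 m n (mat_X m n * mat_Y m n) :: 'k mpoly set)" if "s < n" for s
    unfolding I1_def[of m n "X_at m n s * _"] elements_column[OF that]
    by (rule genideal_minimal[OF I1_XY_ideal(1) I1_XY_ideal(2)[OF that]])
  then show "P_ideal m n n \<subseteq> (I1 m n (mat_X m n * mat_Y m n) :: 'k mpoly set)"
    unfolding P_ideal_def by (auto intro!: ideal_sum[OF I1_XY_ideal(1)])
next
  have "(\<Union>s<n. entry m n s ` {..<m}) \<subseteq> (P_ideal m n n :: 'k mpoly set)"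
    using I1_column_subset_P_ideal[of n n] I1_column_ideal(2) by blast
  then show "I1 m n (mat_X m n * mat_Y m n) \<subseteq> (P_ideal m n n :: 'k mpoly set)"
    unfolding I1_def elements_XY by (rule genideal_minimal[OF P_ideal_ideal[OF order_refl]])
qed

theorem theorem7p3:
  fixes m n :: nat
  assumes "1 \<le> m" and "1 \<le> n"
  shows "(\<forall>s<n. is_reduced_groebner_basis m n
             (G_set m n s :: ('k::field) mpoly set)
             (I1 m n (X_at m n s * Y_at m n s))) \<and>
         (\<forall>t. 1 \<le> t \<and> t \<le> n \<longrightarrow>
             is_reduced_groebner_basis m n
               (\<Union>s<t. (G_set m n s :: 'k mpoly set)) (P_ideal m n t)) \<and>
         (P_ideal m n n :: 'k mpoly set) = I1 m n (mat_X m n * mat_Y m n) \<and>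
         is_reduced_groebner_basis m n
           (\<Union>s<n. (G_set m n s :: 'k mpoly set)) (I1 m n (mat_X m n * mat_Y m n))"
proof -
  have span: "I1 m n (X_at m n s * Y_at m n s) \<subseteq> (mp.span (multiples m n T) :: 'k mpoly set)"
    if "s \<in> T" "T \<subseteq> {..<n}" for s T
    using that elements_column[of s n m] by (intro ideal_subset_span[OF that(2) I1_def]) auto
  have G: "G_set m n s \<subseteq> (I1 m n (X_at m n s * Y_at m n s) :: 'k mpoly set)" if "s < n" for s
    by (rule G_set_subset_ideal[OF I1_column_ideal(1)[OF that] that I1_column_ideal(2)[OF that]])
  have column: "is_reduced_groebner_basis m n (G_set m n s :: 'k mpoly set) (I1 m n (X_at m n s * Y_at m n s))"
    if "s < n" for s
  proof -
    have "is_reduced_groebner_basis m n (\<Union>s'\<in>{s}. G_set m n s' :: 'k mpoly set) (I1 m n (X_at m n s * Y_at m n s))"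
      by (rule reduced_groebner_basis[OF _ I1_column_ideal(1)[OF that]]) (use that G span[of s "{s}"] in auto)
    then show ?thesis by simp
  qed
  have partial: "is_reduced_groebner_basis m n (\<Union>s<t. (G_set m n s :: 'k mpoly set)) (P_ideal m n t)"
    if t: "t \<le> n" for t
  proof (rule reduced_groebner_basis)
    show "P_ideal m n t \<subseteq> (mp.span (multiples m n {..<t}) :: 'k mpoly set)"
      using span[of _ "{..<t}"] t by (auto simp: P_ideal_def intro!: mp.span_sum)
    show "G_set m n s \<subseteq> (P_ideal m n t :: 'k mpoly set)" if "s \<in> {..<t}" for s
      using I1_column_subset_P_ideal[OF t, of s] G[of s] that t by fastforce
  qed (use t in \<open>auto intro: P_ideal_ideal\<close>)
  have "is_reduced_groebner_basis m n (\<Union>s<n. (G_set m n s :: 'k mpoly set)) (I1 m n (mat_X m n * mat_Y m n))"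
    using partial[OF order_refl] unfolding P_ideal_eq_I1 .
  then show ?thesis using column partial P_ideal_eq_I1[of m n, where 'k = 'k]
    by (intro conjI allI impI) simp_all
qed

end
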